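(* Every quasi-arc admits a bi-Lipschitz embedding into some Euclidean space $\mathbb{R}^n$.
   Context: A quasi-arc is a metric space $X$ homeomorphic to $[0,1]$ that is doubling (there is $N$ such that every ball can be covered by $N$ balls of half the radius) and bounded turning (there is $C$ such that each pair of points $x,y\in X$ lies in a continuum, i.e. a compact connected set, of diameter at most $C\,d(x,y)$). A bi-Lipschitz embedding is a map $f$ for which there is $L\ge1$ with $L^{-1}d(x,y)\le|f(x)-f(y)|\le L\,d(x,y)$ for all $x,y$. *)

theory Defs
  imports "HOL-Analysis.Analysis"
begin

text \<open>
  A metric space is a set \<open>X\<close> in a type of class \<^class>\<open>metric_space\<close>, with the restricted
  distance; balls of \<open>X\<close> are open, have their centre in \<open>X\<close> and are intersected with \<open>X\<close>.
\<close>

definition doubling :: "'a::metric_space set \<Rightarrow> bool" where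
  "doubling X \<longleftrightarrow>
     (\<exists>N::nat. \<forall>x\<in>X. \<forall>r>0. \<exists>S. S \<subseteq> X \<and> finite S \<and> card S \<le> N \<and>
        ball x r \<inter> X \<subseteq> (\<Union>s\<in>S. ball s (r / 2) \<inter> X))"

definition bounded_turning :: "'a::metric_space set \<Rightarrow> bool" where
  "bounded_turning X \<longleftrightarrow>
     (\<exists>C::real. \<forall>x\<in>X. \<forall>y\<in>X. \<exists>K. K \<subseteq> X \<and> compact K \<and> connected K \<and>
        x \<in> K \<and> y \<in> K \<and> diameter K \<le> C * dist x y)"

definition quasi_arc :: "'a::metric_space set \<Rightarrow> bool" where
  "quasi_arc X \<longleftrightarrow> X homeomorphic {0..1::real} \<and> doubling X \<and> bounded_turning X"

text \<open>
  The dimension \<open>n\<close> is existentially quantified in the theorem, so it cannot be a type. We use the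
  library's \<^const>\<open>Euclidean_space\<close>, whose points are the sequences \<open>x :: nat \<Rightarrow> real\<close> with
  \<open>x i = 0\<close> for \<open>i \<ge> n\<close>, together with the usual distance given by the \<open>\<ell>\<^sup>2\<close> norm.
\<close>

definition eucl_dist :: "nat \<Rightarrow> (nat \<Rightarrow> real) \<Rightarrow> (nat \<Rightarrow> real) \<Rightarrow> real" where
  "eucl_dist n x y = L2_set (\<lambda>i. x i - y i) {..<n}"

lemma Metric_space_eucl_dist:
  "Metric_space (topspace (Euclidean_space n)) (eucl_dist n)"
proof
  fix x y :: "nat \<Rightarrow> real"
  show "0 \<le> eucl_dist n x y"
    by (simp add: eucl_dist_def)
  show "eucl_dist n x y = eucl_dist n y x"
    by (simp add: eucl_dist_def L2_set_def power2_commute)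
  assume "x \<in> topspace (Euclidean_space n)" "y \<in> topspace (Euclidean_space n)"
  then show "eucl_dist n x y = 0 \<longleftrightarrow> x = y"
    by (fastforce simp: eucl_dist_def L2_set_eq_0_iff topspace_Euclidean_space fun_eq_iff
        not_less[symmetric])
next
  fix x y z :: "nat \<Rightarrow> real"
  have "L2_set (\<lambda>i. (x i - y i) + (y i - z i)) {..<n} \<le> eucl_dist n x y + eucl_dist n y z"
    unfolding eucl_dist_def by (rule L2_set_triangle_ineq)
  then show "eucl_dist n x z \<le> eucl_dist n x y + eucl_dist n y z"
    by (simp add: eucl_dist_def)
qed

definition bilipschitz_embedding ::
    "'a::metric_space set \<Rightarrow> nat \<Rightarrow> ('a \<Rightarrow> nat \<Rightarrow> real) \<Rightarrow> bool" where
  "bilipschitz_embedding X n f \<longleftrightarrow>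
     f ` X \<subseteq> topspace (Euclidean_space n) \<and>
     (\<exists>L::real. L \<ge> 1 \<and> (\<forall>x\<in>X. \<forall>y\<in>X.
        inverse L * dist x y \<le> eucl_dist n (f x) (f y) \<and>
        eucl_dist n (f x) (f y) \<le> L * dist x y))"

end

theory Submission
  imports Defs "HOL-Library.Poly_Mapping"
begin

text \<open>
  Bounded turning makes the metric of the arc comparable to \<open>D s t\<close>, the diameter of the subarc between
  the parameters \<open>s\<close> and \<open>t\<close>, which is monotone under inclusion of subarcs. An arc of diameter
  \<open>w\<close> is cut into consecutive subarcs of diameter \<open>w / 128\<close>, up to a remainder in the last one;
  doubling bounds their number by a constant \<open>M\<close>. A segment of length \<open>w\<close> is replaced by a polygon
  with edges of the same lengths as the diameters of the subarcs and the same ends. The surplus length is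
  spent in directions perpendicular to the segment, and a space with \<open>M\<close> such directions has room for
  well separated edges. Iterating, as for the snowflake curve, gives the embedding.

  The lower bound comes from thin diamonds around segments: the diamonds of the edges lie in the diamond
  of the segment, diamonds of nonadjacent edges have distance comparable to \<open>w\<close>, and consecutive edges
  form an angle that is large compared with the opening of the diamonds.
\<close>

section \<open>Finitely supported functions as an inner product space\<close>

text \<open>The edge of a subarc has exactly the length of its diameter, so a stage reproduces its
  own hypotheses and constants do not decay with depth. One obstacle is that the number
  \<open>n\<close> of pieces is only known to lie between 127 and \<open>M\<close>: a single kind of
  polygon must absorb every surplus, from none, where it is straight, to \<open>M\<close> pieces
  that hardly advance. Another is that two points in adjacent cells can be far closer than the scale
  of the stage. Since adjacent diamonds touch only at a vertex and at a controlled angle, it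
  suffices to compare each point with that vertex; this is decided at the stage where its branch
  leaves the cells that touch the vertex. The constants come from the opening 1/10. Zigzag edges
  stay within \<open>3 * \<delta>\<close> of the segment, so they must keep
  \<open>30 * \<delta>\<close> away from its ends, and the two straight runs together take at most
  \<open>61 * \<delta>\<close>. The ratio 128 leaves a middle part of length at least
  \<open>67 * \<delta>\<close>.\<close>

text \<open>
  The dimension depends on the arc and so cannot be a type; the construction takes place in an
  infinite-dimensional type, in the complete subspace of functions supported below a bound.
\<close>

instantiation poly_mapping :: (type, real_vector) real_vector
begin

definition scaleR_poly_mapping :: "real \<Rightarrow> ('a \<Rightarrow>\<^sub>0 'b) \<Rightarrow> ('a \<Rightarrow>\<^sub>0 'b)" where
  "scaleR_poly_mapping r f = Poly_Mapping.map (scaleR r) f"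

lemma lookup_scaleR:
  "Poly_Mapping.lookup (r *\<^sub>R f) k = r *\<^sub>R Poly_Mapping.lookup (f :: 'a \<Rightarrow>\<^sub>0 'b) k"
  by (simp add: scaleR_poly_mapping_def Poly_Mapping.map.rep_eq when_def)

instance
  by standard (auto intro!: poly_mapping_eqI simp: lookup_scaleR lookup_add algebra_simps)

end

instantiation poly_mapping :: (type, real_inner) real_inner
begin

definition inner_poly_mapping :: "('a \<Rightarrow>\<^sub>0 'b) \<Rightarrow> ('a \<Rightarrow>\<^sub>0 'b) \<Rightarrow> real" where
  "inner_poly_mapping f g =
     (\<Sum>k\<in>Poly_Mapping.keys f. Poly_Mapping.lookup f k \<bullet> Poly_Mapping.lookup g k)"

definition norm_poly_mapping :: "('a \<Rightarrow>\<^sub>0 'b) \<Rightarrow> real" where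
  "norm_poly_mapping f = sqrt (f \<bullet> f)"

definition dist_poly_mapping :: "('a \<Rightarrow>\<^sub>0 'b) \<Rightarrow> ('a \<Rightarrow>\<^sub>0 'b) \<Rightarrow> real" where
  "dist_poly_mapping f g = norm (f - g)"

definition sgn_poly_mapping :: "('a \<Rightarrow>\<^sub>0 'b) \<Rightarrow> ('a \<Rightarrow>\<^sub>0 'b)" where
  "sgn_poly_mapping f = f /\<^sub>R norm f"

definition uniformity_poly_mapping :: "(('a \<Rightarrow>\<^sub>0 'b) \<times> ('a \<Rightarrow>\<^sub>0 'b)) filter" where
  "uniformity_poly_mapping = (INF e\<in>{0<..}. principal {(x, y). dist x y < e})"

definition open_poly_mapping :: "('a \<Rightarrow>\<^sub>0 'b) set \<Rightarrow> bool" where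
  "open_poly_mapping U \<longleftrightarrow> (\<forall>x\<in>U. \<forall>\<^sub>F (x', y) in uniformity. x' = x \<longrightarrow> y \<in> U)"

text \<open>Enlarging the index set lets all sums in the inner product laws range over one common
  finite set.\<close>

lemma inner_poly_mapping_superset:
  fixes f g :: "'a \<Rightarrow>\<^sub>0 'b"
  assumes "finite A" "Poly_Mapping.keys f \<subseteq> A"
  shows "f \<bullet> g = (\<Sum>k\<in>A. Poly_Mapping.lookup f k \<bullet> Poly_Mapping.lookup g k)"
  unfolding inner_poly_mapping_def
  by (rule sum.mono_neutral_left) (use assms in \<open>auto simp: in_keys_iff\<close>)

instance
proof
  fix f g h :: "'a \<Rightarrow>\<^sub>0 'b" and r :: real
  define A where "A = Poly_Mapping.keys f \<union> Poly_Mapping.keys g \<union> Poly_Mapping.keys (f + g)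
    \<union> Poly_Mapping.keys (r *\<^sub>R f)"
  have A: "finite A" "Poly_Mapping.keys f \<subseteq> A" "Poly_Mapping.keys g \<subseteq> A"
      "Poly_Mapping.keys (f + g) \<subseteq> A" "Poly_Mapping.keys (r *\<^sub>R f) \<subseteq> A"
    by (auto simp: A_def)
  note [simp] = A(2-5)[THEN inner_poly_mapping_superset[OF A(1)]]
  show "f \<bullet> g = g \<bullet> f"
    by (simp add: inner_commute)
  show "(f + g) \<bullet> h = f \<bullet> h + g \<bullet> h"
    by (simp add: lookup_add inner_add_left sum.distrib)
  show "(r *\<^sub>R f) \<bullet> h = r * (f \<bullet> h)"
    by (simp add: lookup_scaleR sum_distrib_left)
  show "0 \<le> f \<bullet> f"
    by (simp add: sum_nonneg)
  show "f \<bullet> f = 0 \<longleftrightarrow> f = 0"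
    by (simp add: sum_nonneg_eq_0_iff A(1) poly_mapping_eq_iff fun_eq_iff)
       (use A(2) in \<open>auto simp: in_keys_iff\<close>)
qed (simp_all add: norm_poly_mapping_def dist_poly_mapping_def sgn_poly_mapping_def
      uniformity_poly_mapping_def open_poly_mapping_def)

end

text \<open>A copy of complex \<open>m\<close>-space, of real dimension
  \<open>2 * m\<close>.\<close>

definition supported_below :: "nat \<Rightarrow> (nat \<Rightarrow>\<^sub>0 complex) set" where
  "supported_below m = {f. Poly_Mapping.keys f \<subseteq> {..<m}}"

lemma subspace_supported_below: "subspace (supported_below m)"
  unfolding subspace_def supported_below_def
  by (auto simp: in_keys_iff lookup_add lookup_scaleR subset_iff) (metis add.right_neutral)

lemma inner_supported_below:
  assumes "f \<in> supported_below m"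
  shows "f \<bullet> g = (\<Sum>k<m. Poly_Mapping.lookup f k \<bullet> Poly_Mapping.lookup g k)"
  using assms by (intro inner_poly_mapping_superset) (auto simp: supported_below_def)

lemma norm_lookup_le:
  assumes "f \<in> supported_below m"
  shows "norm (Poly_Mapping.lookup f k) \<le> norm f"
proof (cases "k < m")
  case True
  have "(norm (Poly_Mapping.lookup f k))\<^sup>2 \<le> (\<Sum>k<m. (norm (Poly_Mapping.lookup f k))\<^sup>2)"
    using True by (intro member_le_sum) auto
  also have "\<dots> = (norm f)\<^sup>2"
    by (simp add: power2_norm_eq_inner inner_supported_below[OF assms])
  finally show ?thesis
    by (rule power2_le_imp_le) simp
next
  case False
  then have "Poly_Mapping.lookup f k = 0"
    using assms by (auto simp: supported_below_def in_keys_iff)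
  then show ?thesis by simp
qed

text \<open>The whole type is incomplete; the common bound \<open>m\<close> on the supports lets
  limits be taken coordinate by coordinate.\<close>

lemma complete_supported_below: "complete (supported_below m)"
  unfolding complete_def
proof (intro allI impI, elim conjE)
  fix F :: "nat \<Rightarrow> nat \<Rightarrow>\<^sub>0 complex"
  assume mem: "\<forall>n. F n \<in> supported_below m" and Cauchy: "Cauchy F"
  have "Cauchy (\<lambda>n. Poly_Mapping.lookup (F n) k)" for k
  proof (rule metric_CauchyI)
    fix e :: real assume "0 < e"
    then obtain M where M: "\<forall>i\<ge>M. \<forall>j\<ge>M. dist (F i) (F j) < e"
      using Cauchy unfolding Cauchy_def by blast
    have "dist (Poly_Mapping.lookup (F i) k) (Poly_Mapping.lookup (F j) k) < e"
      if "i \<ge> M" "j \<ge> M" for i j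
    proof -
      have "F i - F j \<in> supported_below m"
        using mem by (intro subspace_diff subspace_supported_below) auto
      from norm_lookup_le[OF this, of k] show ?thesis
        using M that by (auto simp: dist_norm lookup_minus intro: le_less_trans)
    qed
    then show "\<exists>M. \<forall>i\<ge>M. \<forall>j\<ge>M.
        dist (Poly_Mapping.lookup (F i) k) (Poly_Mapping.lookup (F j) k) < e"
      by blast
  qed
  then have "\<exists>l. \<forall>k. (\<lambda>n. Poly_Mapping.lookup (F n) k) \<longlonglongrightarrow> l k"
    by (intro choice allI) (simp add: Cauchy_convergent_iff convergent_def)
  then obtain l where l: "\<And>k. (\<lambda>n. Poly_Mapping.lookup (F n) k) \<longlonglongrightarrow> l k"
    by blast
  define L where "L = (\<Sum>k<m. Poly_Mapping.single k (l k))"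
  have lookup_L: "Poly_Mapping.lookup L k = (if k < m then l k else 0)" for k
    by (simp add: L_def lookup_sum lookup_single when_def)
  have L: "L \<in> supported_below m"
    by (auto simp: supported_below_def in_keys_iff lookup_L split: if_splits)
  have "norm (F n - L) = sqrt (\<Sum>k<m. (norm (Poly_Mapping.lookup (F n) k - l k))\<^sup>2)" for n
  proof -
    have "F n - L \<in> supported_below m"
      using mem L by (intro subspace_diff subspace_supported_below) auto
    then have "norm (F n - L) = sqrt (\<Sum>k<m. (norm (Poly_Mapping.lookup (F n - L) k))\<^sup>2)"
      by (simp add: norm_eq_sqrt_inner inner_supported_below power2_norm_eq_inner del: real_norm_def)
    then show ?thesis
      by (simp add: lookup_minus lookup_L)
  qed
  moreover have "(\<lambda>n. sqrt (\<Sum>k<m. (norm (Poly_Mapping.lookup (F n) k - l k))\<^sup>2)) \<longlonglongrightarrow>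
      sqrt (\<Sum>k<m. (norm (l k - l k))\<^sup>2)"
    by (intro tendsto_intros l)
  ultimately have "(\<lambda>n. norm (F n - L)) \<longlonglongrightarrow> 0"
    by simp
  then have "F \<longlonglongrightarrow> L"
    by (rule LIM_zero_cancel[OF tendsto_norm_zero_cancel])
  with L show "\<exists>l\<in>supported_below m. F \<longlonglongrightarrow> l"
    by blast
qed

text \<open>
  Complex coordinates are used because each of them leaves room for a unit vector perpendicular to a
  given one.
\<close>

lemma unit_complex_orthogonal: "\<exists>c::complex. norm c = 1 \<and> c \<bullet> z = 0"
proof (cases "z = 0")
  case True
  then show ?thesis by (intro exI[of _ 1]) simp
next
  case False
  then show ?thesis
    by (intro exI[of _ "\<i> * sgn z"]) (simp add: norm_mult norm_sgn inner_complex_def sgn_div_norm field_simps)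
qed

text \<open>One vector per coordinate: \<open>single i (c i)\<close> with \<open>c i\<close>
  perpendicular to the coordinate \<open>i\<close> of \<open>v\<close>. Distinct supports make these
  vectors orthogonal.\<close>

lemma orthonormal_frame_supported_below:
  obtains u where "\<And>i. i < m \<Longrightarrow> u i \<in> supported_below m"
    and "\<And>i j. i < m \<Longrightarrow> j < m \<Longrightarrow> u i \<bullet> u j = (if i = j then 1 else 0)"
    and "\<And>i. i < m \<Longrightarrow> u i \<bullet> v = 0"
proof -
  have "\<exists>c. \<forall>i. norm (c i) = 1 \<and> c i \<bullet> Poly_Mapping.lookup v i = 0"
    by (intro choice allI unit_complex_orthogonal)
  then obtain c where c: "\<And>i. norm (c i) = 1" "\<And>i. c i \<bullet> Poly_Mapping.lookup v i = 0"
    by blast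
  let ?u = "\<lambda>i. Poly_Mapping.single i (c i)"
  have mem: "?u i \<in> supported_below m" if "i < m" for i
    using that by (auto simp: supported_below_def)
  have inner_u: "?u i \<bullet> w = c i \<bullet> Poly_Mapping.lookup w i" if "i < m" for i and w :: "nat \<Rightarrow>\<^sub>0 complex"
  proof -
    have "?u i \<bullet> w = (\<Sum>k<m. if k = i then c i \<bullet> Poly_Mapping.lookup w i else 0)"
      unfolding inner_supported_below[OF mem[OF that]]
      by (intro sum.cong) (auto simp: lookup_single when_def)
    then show ?thesis
      using that by simp
  qed
  show thesis
    by (rule that[of ?u])
       (use c mem in \<open>auto simp: inner_u lookup_single when_def norm_eq_1\<close>)
qed

section \<open>Diamonds and polygons\<close>

text \<open>A thin double cone with tips \<open>p\<close> and \<open>q\<close>. As a union of balls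
  centred on the segment it hands every proof a foot point with parameter \<open>s\<close>.\<close>

definition diamond :: "'e::real_inner \<Rightarrow> 'e \<Rightarrow> 'e set" where
  "diamond p q = {z. \<exists>s\<in>{0..1}. norm (z - p - s *\<^sub>R (q - p)) \<le> min s (1 - s) / 10 * norm (q - p)}"

lemma diamondE:
  assumes "z \<in> diamond p q"
  obtains s r where "0 \<le> s" "s \<le> 1" "z = p + s *\<^sub>R (q - p) + r"
    "norm r \<le> min s (1 - s) / 10 * norm (q - p)"
proof -
  from assms obtain s where "0 \<le> s" "s \<le> 1"
      "norm (z - p - s *\<^sub>R (q - p)) \<le> min s (1 - s) / 10 * norm (q - p)"
    by (auto simp: diamond_def)
  then show thesis
    by (intro that[of s "z - p - s *\<^sub>R (q - p)"]) auto
qed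

lemma left_mem_diamond: "p \<in> diamond p q"
  by (auto simp: diamond_def intro!: bexI[of _ 0])

lemma right_mem_diamond: "q \<in> diamond p q"
  by (auto simp: diamond_def intro!: bexI[of _ 1])

lemma diamond_dist_left:
  assumes "z \<in> diamond p q"
  shows "norm (z - p) \<le> 2 * norm (q - p)"
proof -
  obtain s r where s: "0 \<le> s" "s \<le> 1" "z = p + s *\<^sub>R (q - p) + r"
      "norm r \<le> min s (1 - s) / 10 * norm (q - p)"
    using assms by (rule diamondE)
  have "norm (z - p) \<le> norm (s *\<^sub>R (q - p)) + norm r"
    unfolding s(3) by (rule order_trans[OF _ norm_triangle_ineq]) simp
  also have "\<dots> \<le> 1 * norm (q - p) + 1 * norm (q - p)"
    using s(1,2) unfolding norm_scaleR
    by (intro add_mono order_trans[OF s(4)] mult_right_mono) auto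
  finally show ?thesis by simp
qed

lemma diamond_commute: "diamond p q = diamond q p"
proof -
  have "diamond p q \<subseteq> diamond q p" for p q :: 'a
  proof
    fix z assume "z \<in> diamond p q"
    then obtain s r where s: "0 \<le> s" "s \<le> 1" "z = p + s *\<^sub>R (q - p) + r"
        "norm r \<le> min s (1 - s) / 10 * norm (q - p)"
      by (rule diamondE)
    moreover have "z - q - (1 - s) *\<^sub>R (p - q) = r"
      unfolding s(3) by (simp add: algebra_simps)
    ultimately have "norm (z - q - (1 - s) *\<^sub>R (p - q)) \<le> min (1 - s) (1 - (1 - s)) / 10 * norm (p - q)"
      using s(4) by (simp only: norm_minus_commute[of p q] min.commute[of "1 - s"]) simp
    then show "z \<in> diamond q p"
      unfolding diamond_def using s(1,2) by (intro CollectI bexI[of _ "1 - s"]) auto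
  qed
  then show ?thesis by blast
qed

lemma diamond_dist_right:
  "z \<in> diamond p q \<Longrightarrow> norm (z - q) \<le> 2 * norm (q - p)"
  using diamond_dist_left[of z q p] by (simp add: diamond_commute norm_minus_commute)

text \<open>The foot parameters \<open>s n\<close> lie in a compact interval, so a convergent
  subsequence carries the inequality to the limit.\<close>

lemma closed_diamond: "closed (diamond p q)"
  unfolding closed_sequential_limits
proof (intro allI impI, elim conjE)
  fix x l assume mem: "\<forall>n. x n \<in> diamond p q" and lim: "x \<longlonglongrightarrow> l"
  have "\<exists>s. \<forall>n. s n \<in> {0..1} \<and> norm (x n - p - s n *\<^sub>R (q - p)) \<le> min (s n) (1 - s n) / 10 * norm (q - p)"
    using mem unfolding diamond_def by (intro choice) blast
  then obtain s :: "nat \<Rightarrow> real" where s: "\<And>n. s n \<in> {0..1}"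
      "\<And>n. norm (x n - p - s n *\<^sub>R (q - p)) \<le> min (s n) (1 - s n) / 10 * norm (q - p)"
    by blast
  obtain t and \<rho> :: "nat \<Rightarrow> nat" where t: "t \<in> {0..1}" and \<rho>: "strict_mono \<rho>" "(s \<circ> \<rho>) \<longlonglongrightarrow> t"
    using s(1) compact_Icc[of "0::real" 1] unfolding compact_def by metis
  have "norm (l - p - t *\<^sub>R (q - p)) \<le> min t (1 - t) / 10 * norm (q - p)"
  proof (rule LIMSEQ_le)
    show "(\<lambda>n. norm ((x \<circ> \<rho>) n - p - (s \<circ> \<rho>) n *\<^sub>R (q - p))) \<longlonglongrightarrow> norm (l - p - t *\<^sub>R (q - p))"
      by (intro tendsto_intros \<rho> LIMSEQ_subseq_LIMSEQ[OF lim])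
    show "(\<lambda>n. min ((s \<circ> \<rho>) n) (1 - (s \<circ> \<rho>) n) / 10 * norm (q - p)) \<longlonglongrightarrow> min t (1 - t) / 10 * norm (q - p)"
      by (intro tendsto_intros tendsto_min \<rho>) simp
  qed (use s(2) in auto)
  with t show "l \<in> diamond p q"
    by (auto simp: diamond_def)
qed

text \<open>Directions at most 120 degrees apart: after squaring, the two sides differ by at least
  \<open>3/4 * (norm x - norm y)\<^sup>2\<close>.\<close>

lemma norm_add_obtuse_ge:
  fixes x y :: "'e::real_inner"
  assumes "x \<bullet> y \<ge> - 1/2 * (norm x * norm y)"
  shows "norm (x + y) \<ge> (norm x + norm y) / 2"
proof (rule power2_le_imp_le)
  have "(norm (x + y))\<^sup>2 = (norm x)\<^sup>2 + 2 * (x \<bullet> y) + (norm y)\<^sup>2"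
    by (simp add: power2_norm_eq_inner inner_add inner_commute)
  moreover have "0 \<le> 3/4 * (norm x - norm y)\<^sup>2"
    by simp
  ultimately show "((norm x + norm y) / 2)\<^sup>2 \<le> (norm (x + y))\<^sup>2"
    using assms by (simp add: power2_eq_square algebra_simps)
qed simp

text \<open>Foot points on the two axes are separated by half the sum of their distances from
  \<open>q\<close>, and the radii cost a tenth of that sum. Thus 2/5 remains, against a factor 11/10
  between cone points and foot points, and \<open>2/5 \<ge> 11/30\<close>.\<close>

lemma adjacent_diamonds_separated:
  fixes p q r :: "'e::real_inner"
  assumes angle: "(q - p) \<bullet> (r - q) \<ge> - 1/2 * (norm (q - p) * norm (r - q))"
    and z: "z \<in> diamond p q" and z': "z' \<in> diamond q r"
  shows "norm (z' - z) \<ge> (norm (z - q) + norm (z' - q)) / 3"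
proof -
  \<comment> \<open>The first diamond is reversed so that both parameters are measured from the
    common tip \<open>q\<close>.\<close>
  obtain s a where s: "0 \<le> s" "z = q + s *\<^sub>R (p - q) + a" "norm a \<le> min s (1 - s) / 10 * norm (p - q)"
    using z unfolding diamond_commute[of p q] by (auto elim: diamondE)
  obtain t b where t: "0 \<le> t" "z' = q + t *\<^sub>R (r - q) + b" "norm b \<le> min t (1 - t) / 10 * norm (r - q)"
    using z' by (auto elim: diamondE)
  define x y where "x = s *\<^sub>R (q - p)" and "y = t *\<^sub>R (r - q)"
  have "norm a \<le> s / 10 * norm (p - q)"
    by (intro order_trans[OF s(3)] mult_right_mono) auto
  then have a: "norm a \<le> norm x / 10"
    using s(1) by (simp add: x_def norm_minus_commute)
  have "norm b \<le> t / 10 * norm (r - q)"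
    by (intro order_trans[OF t(3)] mult_right_mono) auto
  then have b: "norm b \<le> norm y / 10"
    using t(1) by (simp add: y_def)
  have "- 1/2 * (norm x * norm y) = s * t * (- 1/2 * (norm (q - p) * norm (r - q)))"
    using s(1) t(1) by (simp add: x_def y_def)
  also have "\<dots> \<le> s * t * ((q - p) \<bullet> (r - q))"
    using s(1) t(1) angle by (intro mult_left_mono) auto
  also have "\<dots> = x \<bullet> y"
    by (simp add: x_def y_def)
  finally have xy: "norm (x + y) \<ge> (norm x + norm y) / 2"
    by (rule norm_add_obtuse_ge)
  have zq: "z - q = a - x" and zq': "z' - q = y + b"
    unfolding s t x_def y_def by (simp_all add: algebra_simps)
  have "z' - z = (x + y) + (b - a)"
    using zq zq' by (simp add: algebra_simps)
  then have "norm (z' - z) \<ge> norm (x + y) - norm (b - a)"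
    using norm_diff_ineq[of "x + y" "b - a"] by simp
  moreover have "norm (b - a) \<le> norm b + norm a" "norm (z - q) \<le> norm a + norm x"
      "norm (z' - q) \<le> norm y + norm b"
    unfolding zq zq' by (rule norm_triangle_ineq4 norm_triangle_ineq)+
  ultimately show ?thesis
    using a b xy norm_ge_zero[of x] norm_ge_zero[of y] by argo
qed

text \<open>
  The polygon \<open>P\<close> runs through 30 edges on the segment from \<open>p\<close> to \<open>q\<close>, then through edges joining
  different axes \<open>u i\<close>, then through 30 edges on the segment again. The straight ends keep the
  deviation of the middle part inside the diamond of \<open>p\<close> and \<open>q\<close>; the distinct axes separate the edges
  of the middle part, however small their progress \<open>dx\<close> along the segment is. The last edge, which is
  straight, absorbs the remainder \<open>\<epsilon>\<close> of the subdivision.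
\<close>

locale zigzag =
  fixes p q :: "'e::real_inner" and \<delta> \<epsilon> :: real and n :: nat and u :: "nat \<Rightarrow> 'e"
  assumes delta_pos: "0 < \<delta>"
    and dist_pq: "norm (q - p) = 128 * \<delta>"
    and ell: "\<delta> \<le> \<epsilon>" "\<epsilon> \<le> 2 * \<delta>"
    and total_length: "128 * \<delta> \<le> (real n - 1) * \<delta> + \<epsilon>"
    and orthonormal: "\<And>i j. i < n \<Longrightarrow> j < n \<Longrightarrow> u i \<bullet> u j = (if i = j then 1 else 0)"
    and orthogonal: "\<And>i. i < n \<Longrightarrow> u i \<bullet> (q - p) = 0"
begin

text \<open>
  \<open>dx\<close> makes the middle part end at distance \<open>29 * \<delta> + \<epsilon>\<close> from \<open>q\<close>, and \<open>h\<close> solves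
  \<open>dx\<^sup>2 + 2 * h\<^sup>2 = \<delta>\<^sup>2\<close>, the condition that the middle edges have length \<open>\<delta>\<close>.
\<close>

definition "dx = (69 * \<delta> - \<epsilon>) / (real n - 60)"
definition "h = sqrt ((\<delta>\<^sup>2 - dx\<^sup>2) / 2)"
definition "e = (q - p) /\<^sub>R (128 * \<delta>)"
definition "len i = (if Suc i = n then \<epsilon> else \<delta>)"
text \<open>Middle progress is counted from \<open>p\<close>, the final run backwards from
  \<open>q\<close>; \<open>X n\<close> is set apart because the last edge has length
  \<open>\<epsilon>\<close>.\<close>

definition "X i = (if i \<le> 30 then real i * \<delta> else if i + 30 \<le> n then 30 * \<delta> + (real i - 30) * dx
   else if i < n then 128 * \<delta> - \<epsilon> - (real n - 1 - real i) * \<delta> else 128 * \<delta>)"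
text \<open>Vertices 31 to \<open>n - 31\<close> get the distinct labels 1 to \<open>n - 61\<close>,
  all others the label 0. In \<open>Y\<close>, subtracting \<open>u 0\<close> returns the latter to
  the segment, and a middle edge moves from one axis to another, with transverse part of squared
  length \<open>2 * h\<^sup>2\<close>.\<close>

definition "c i = (if i \<le> 30 \<or> n \<le> i + 30 then 0 else i - 30)"
definition "Y i = h *\<^sub>R (u (c i) - u 0)"
definition "P i = p + X i *\<^sub>R e + Y i"
text \<open>A property of the edge from \<open>P i\<close> to \<open>P (Suc i)\<close>, not of the
  vertex: 30 edges at each end.\<close>

definition "straight i \<longleftrightarrow> i < 30 \<or> n \<le> i + 30"

lemma n_ge: "n \<ge> 127"
proof -
  have "127 * \<delta> \<le> real n * \<delta>"
    using total_length ell by (simp add: algebra_simps)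
  then show ?thesis
    using delta_pos by simp
qed

text \<open>The bound \<open>dx \<le> \<delta>\<close> is \<open>total_length\<close> solved for
  \<open>dx\<close>: the pieces are long enough to reach from \<open>p\<close> to
  \<open>q\<close>.\<close>

lemma dx: "0 < dx" "dx \<le> \<delta>" "(real n - 60) * dx = 69 * \<delta> - \<epsilon>"
proof -
  have n: "real n - 60 > 0" using n_ge by simp
  show "0 < dx" unfolding dx_def
    using n ell delta_pos by simp
  show "(real n - 60) * dx = 69 * \<delta> - \<epsilon>"
    using n by (simp add: dx_def)
  show "dx \<le> \<delta>" unfolding dx_def
    using n total_length by (simp add: divide_le_eq algebra_simps)
qed

lemma h: "0 \<le> h" "h\<^sup>2 = (\<delta>\<^sup>2 - dx\<^sup>2) / 2" "h \<le> \<delta>"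
proof -
  have *: "dx\<^sup>2 \<le> \<delta>\<^sup>2"
    using dx by (intro power_mono) auto
  then show "0 \<le> h" and h2: "h\<^sup>2 = (\<delta>\<^sup>2 - dx\<^sup>2) / 2"
    by (simp_all add: h_def)
  have "h\<^sup>2 \<le> \<delta>\<^sup>2"
    unfolding h2 by (simp add: add_increasing2)
  then show "h \<le> \<delta>"
    using delta_pos by (metis less_eq_real_def power2_le_imp_le)
qed

lemma e: "e \<bullet> e = 1" "norm e = 1" "q - p = (128 * \<delta>) *\<^sub>R e" "i < n \<Longrightarrow> u i \<bullet> e = 0" "i < n \<Longrightarrow> e \<bullet> u i = 0"
proof -
  show "norm e = 1"
    using delta_pos by (simp add: e_def dist_pq)
  then show "e \<bullet> e = 1"
    by (simp add: norm_eq_1)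
  show "q - p = (128 * \<delta>) *\<^sub>R e"
    using delta_pos by (simp add: e_def)
  show "i < n \<Longrightarrow> u i \<bullet> e = 0" "i < n \<Longrightarrow> e \<bullet> u i = 0"
    using orthogonal by (simp_all add: e_def inner_commute[of _ "u i"])
qed

lemma c_less: "i \<le> n \<Longrightarrow> c i < n" and zero_less_n: "0 < n"
  using n_ge by (auto simp: c_def)

lemma inner_e_Y [simp]: "i \<le> n \<Longrightarrow> e \<bullet> Y i = 0"
  by (simp add: Y_def inner_diff_right e c_less zero_less_n)

lemma inner_Y_e [simp]: "i \<le> n \<Longrightarrow> Y i \<bullet> e = 0"
  by (simp add: inner_commute)

lemma inner_Y_u:
  "i \<le> n \<Longrightarrow> a < n \<Longrightarrow> Y i \<bullet> u a = h * ((if c i = a then 1 else 0) - (if a = 0 then 1 else 0))"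
  using c_less[of i] zero_less_n by (simp add: Y_def inner_diff_left orthonormal)

lemma Y_straight: "straight i \<Longrightarrow> i < n \<Longrightarrow> Y i = 0 \<and> Y (Suc i) = 0"
  by (auto simp: straight_def Y_def c_def)

lemma norm_Y_le: "i \<le> n \<Longrightarrow> norm (Y i) \<le> 2 * \<delta>"
proof -
  assume "i \<le> n"
  then have "norm (u (c i)) = 1" "norm (u 0) = 1"
    using orthonormal[of "c i" "c i"] orthonormal[of 0 0] c_less[of i] zero_less_n
    by (simp_all add: norm_eq_1)
  then have "norm (u (c i) - u 0) \<le> 2"
    using norm_triangle_ineq4[of "u (c i)" "u 0"] by simp
  then have "h * norm (u (c i) - u 0) \<le> \<delta> * 2"
    using h by (intro mult_mono) auto
  then show ?thesis
    using h by (simp add: Y_def)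
qed

lemma X_step: "i < n \<Longrightarrow> X (Suc i) - X i = (if straight i then len i else dx)"
proof -
  assume i: "i < n"
  consider "i < 30" | "30 \<le> i" "i + 30 < n" | "30 < i" "i + 30 = n" | "n < i + 30" "Suc i < n" | "Suc i = n"
    using i n_ge by linarith
  then show ?thesis
  proof cases
    case 1
    then show ?thesis using n_ge by (simp add: X_def straight_def len_def algebra_simps)
  next
    case 2
    then show ?thesis by (auto simp: X_def straight_def len_def algebra_simps)
  next
    \<comment> \<open>Edge \<open>n - 30\<close> joins the two formulas for \<open>X\<close>; the
      choice of \<open>dx\<close> makes its step \<open>\<delta>\<close>.\<close>
    case 3
    then have "real n = real i + 30" by linarith
    moreover from this have "(real i - 30) * dx = 69 * \<delta> - \<epsilon>"
      unfolding dx(3)[symmetric] by simp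
    ultimately show ?thesis using 3
      by (auto simp: X_def straight_def len_def algebra_simps)
  next
    case 4
    then show ?thesis using n_ge by (auto simp: X_def straight_def len_def algebra_simps)
  next
    case 5
    then have "real n = real i + 1" by linarith
    then show ?thesis using n_ge 5 by (auto simp: X_def straight_def len_def algebra_simps)
  qed
qed

lemma len: "\<delta> \<le> len i" "len i \<le> 2 * \<delta>" "0 < len i"
  using ell delta_pos by (auto simp: len_def)

lemma X_step_ge: "i < n \<Longrightarrow> X i + dx \<le> X (Suc i)"
  using X_step[of i] dx len[of i] by (auto split: if_splits)

lemma X_mono: "i \<le> j \<Longrightarrow> j \<le> n \<Longrightarrow> X i \<le> X j"
proof (induction rule: dec_induct)
  case (step m)
  then show ?case using X_step_ge[of m] dx(1) by simp
qed simp

lemma X_0: "X 0 = 0" and X_n: "X n = 128 * \<delta>"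
  using n_ge by (simp_all add: X_def)

lemma P_0: "P 0 = p" and P_n: "P n = q"
  using e(3) by (simp_all add: P_def X_0 X_n Y_def c_def algebra_simps)

lemma P_step: "i < n \<Longrightarrow> P (Suc i) - P i = (X (Suc i) - X i) *\<^sub>R e + (Y (Suc i) - Y i)"
  by (simp add: P_def algebra_simps)

lemma norm_P_step: "i < n \<Longrightarrow> norm (P (Suc i) - P i) = len i"
proof (cases "straight i")
  case True
  assume "i < n"
  then show ?thesis
    using len[of i] by (simp add: P_step X_step True Y_straight e)
next
  case False
  assume "i < n"
  with False have i: "30 \<le> i" "i + 30 < n" "len i = \<delta>" "c i \<noteq> c (Suc i)"
    using n_ge by (auto simp: straight_def len_def c_def)
  have Y: "Y (Suc i) - Y i = h *\<^sub>R (u (c (Suc i)) - u (c i))"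
    by (simp add: Y_def algebra_simps)
  have "(norm (P (Suc i) - P i))\<^sup>2 = dx\<^sup>2 + 2 * h\<^sup>2"
    unfolding P_step[OF \<open>i < n\<close>] power2_norm_eq_inner X_step[OF \<open>i < n\<close>] Y
    using False i c_less[of i] c_less[of "Suc i"]
    by (simp add: inner_add inner_diff e orthonormal) (simp add: power2_eq_square algebra_simps)
  also have "\<dots> = \<delta>\<^sup>2"
    unfolding h(2) by argo
  finally show ?thesis
    using delta_pos i by simp
qed

text \<open>A straight edge gives a product of two nonnegative progresses. Two consecutive zigzag
  edges share only the middle axis, with opposite signs, so the product is
  \<open>dx\<^sup>2 - h\<^sup>2\<close>, at least minus half of
  \<open>\<delta>\<^sup>2\<close>.\<close>

lemma P_angle:
  assumes "Suc i < n"
  shows "(P (Suc i) - P i) \<bullet> (P (Suc (Suc i)) - P (Suc i)) \<ge>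
    - 1/2 * (norm (P (Suc i) - P i) * norm (P (Suc (Suc i)) - P (Suc i)))"
proof (cases "straight i \<or> straight (Suc i)")
  case True
  have "(P (Suc i) - P i) \<bullet> (P (Suc (Suc i)) - P (Suc i)) = (X (Suc i) - X i) * (X (Suc (Suc i)) - X (Suc i))"
    using assms True Y_straight[of i] Y_straight[of "Suc i"]
    by (auto simp: P_step inner_add inner_diff e)
  also have "\<dots> \<ge> 0"
    using X_step_ge[of i] X_step_ge[of "Suc i"] dx(1) assms by (intro mult_nonneg_nonneg) auto
  finally show ?thesis
    by (rule order_trans[rotated]) simp
next
  case False
  with assms have i: "30 \<le> i" "Suc i + 30 < n" "len i = \<delta>" "len (Suc i) = \<delta>"
      "c i \<noteq> c (Suc i)" "c (Suc i) \<noteq> c (Suc (Suc i))" "c i \<noteq> c (Suc (Suc i))"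
    using n_ge by (auto simp: straight_def len_def c_def)
  have Y: "Y (Suc i) - Y i = h *\<^sub>R (u (c (Suc i)) - u (c i))" for i
    by (simp add: Y_def algebra_simps)
  have "(P (Suc i) - P i) \<bullet> (P (Suc (Suc i)) - P (Suc i)) = dx\<^sup>2 - h\<^sup>2"
    using assms False i c_less[of i] c_less[of "Suc i"] c_less[of "Suc (Suc i)"]
    by (simp add: P_step X_step Y inner_add inner_diff e orthonormal) (simp add: power2_eq_square algebra_simps)
  also have "\<dots> \<ge> - 1/2 * (\<delta> * \<delta>)"
    unfolding h(2) by (simp add: power2_eq_square algebra_simps)
  finally show ?thesis
    using assms i by (simp add: norm_P_step)
qed

lemma diamond_P_E:
  assumes "z \<in> diamond (P i) (P (Suc i))" "i < n"
  obtains s r where "0 \<le> s" "s \<le> 1" "norm r \<le> min s (1 - s) / 10 * len i"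
    "z = p + ((1 - s) * X i + s * X (Suc i)) *\<^sub>R e + ((1 - s) *\<^sub>R Y i + s *\<^sub>R Y (Suc i)) + r"
proof -
  obtain s r where s: "0 \<le> s" "s \<le> 1" "z = P i + s *\<^sub>R (P (Suc i) - P i) + r"
      "norm r \<le> min s (1 - s) / 10 * norm (P (Suc i) - P i)"
    using assms(1) by (rule diamondE)
  show thesis
  proof (rule that[OF s(1,2)])
    show "norm r \<le> min s (1 - s) / 10 * len i"
      using s(4) by (simp add: norm_P_step assms)
    show "z = p + ((1 - s) * X i + s * X (Suc i)) *\<^sub>R e + ((1 - s) *\<^sub>R Y i + s *\<^sub>R Y (Suc i)) + r"
      unfolding s(3) P_def by (simp add: algebra_simps)
  qed
qed

text \<open>Along a straight edge the small cone is narrower than the large one. On the middle part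
  the offset \<open>2 * \<delta>\<close> and the radius add up to at most
  \<open>3 * \<delta>\<close>, while both ends are at least \<open>30 * \<delta>\<close>
  away.\<close>

lemma diamond_P_subset:
  assumes "i < n"
  shows "diamond (P i) (P (Suc i)) \<subseteq> diamond p q"
proof
  fix z assume "z \<in> diamond (P i) (P (Suc i))"
  then obtain s r where s: "0 \<le> s" "s \<le> 1" and r: "norm r \<le> min s (1 - s) / 10 * len i"
    and z: "z = p + ((1 - s) * X i + s * X (Suc i)) *\<^sub>R e + ((1 - s) *\<^sub>R Y i + s *\<^sub>R Y (Suc i)) + r"
    using assms by (rule diamond_P_E)
  define x where "x = (1 - s) * X i + s * X (Suc i)"
  define y where "y = (1 - s) *\<^sub>R Y i + s *\<^sub>R Y (Suc i)"
  have x_eq: "x = X i + s * (X (Suc i) - X i)" "x = X (Suc i) - (1 - s) * (X (Suc i) - X i)"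
    by (simp_all add: x_def algebra_simps)
  have X: "0 \<le> X i" "X (Suc i) \<le> 128 * \<delta>" "X i \<le> X (Suc i)"
    using X_mono[of 0 i] X_mono[of "Suc i" n] X_mono[of i "Suc i"] assms by (simp_all add: X_0 X_n)
  have bound: "norm (y + r) \<le> min x (128 * \<delta> - x) / 10"
  proof (cases "straight i")
    case True
    have "s * len i \<le> x" "(1 - s) * len i \<le> 128 * \<delta> - x"
      using X True assms unfolding x_eq(1) by (simp_all add: X_step algebra_simps)
         (use x_eq X_step[OF assms] in \<open>simp add: algebra_simps\<close>)
    moreover have "min s (1 - s) * len i \<le> s * len i" "min s (1 - s) * len i \<le> (1 - s) * len i"
      using len(3)[of i] by (auto intro!: mult_right_mono)
    moreover have "y = 0"
      using Y_straight[OF True assms] by (simp add: y_def)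
    ultimately show ?thesis using r by simp
  next
    case False
    then have i: "30 \<le> i" "Suc i + 30 \<le> n"
      using assms by (auto simp: straight_def)
    have X': "30 * \<delta> \<le> X i" "X (Suc i) \<le> 98 * \<delta>"
    proof -
      have "X 30 = 30 * \<delta>" by (simp add: X_def)
      then show "30 * \<delta> \<le> X i" using X_mono[OF i(1)] assms by simp
      have "\<not> n - 30 \<le> 30"
        using n_ge by simp
      then have "X (n - 30) = 30 * \<delta> + (real n - 60) * dx"
        by (simp add: X_def of_nat_diff algebra_simps)
      then show "X (Suc i) \<le> 98 * \<delta>"
        using X_mono[of "Suc i" "n - 30"] i dx(3) ell by linarith
    qed
    have x: "30 * \<delta> \<le> x" "x \<le> 98 * \<delta>"
      using s X X' mult_nonneg_nonneg[of s "X (Suc i) - X i"] mult_nonneg_nonneg[of "1 - s" "X (Suc i) - X i"] x_eq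
      by linarith+
    have "norm y \<le> (1 - s) * norm (Y i) + s * norm (Y (Suc i))"
      using norm_triangle_ineq[of "(1 - s) *\<^sub>R Y i" "s *\<^sub>R Y (Suc i)"] s by (simp add: y_def)
    also have "\<dots> \<le> (1 - s) * (2 * \<delta>) + s * (2 * \<delta>)"
      using s assms by (intro add_mono mult_left_mono norm_Y_le) auto
    finally have "norm y \<le> 2 * \<delta>"
      by (simp add: algebra_simps)
    moreover have "norm r \<le> 1 / 10 * (2 * \<delta>)"
      using s len[of i] by (intro order_trans[OF r] mult_mono) auto
    ultimately have "norm (y + r) \<le> 3 * \<delta>"
      using norm_triangle_ineq[of y r] delta_pos by simp
    then show ?thesis
      using x by simp
  qed
  have "z - p - (x / (128 * \<delta>)) *\<^sub>R (q - p) = y + r"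
    using delta_pos unfolding z e(3) x_def[symmetric] y_def[symmetric] by simp
  moreover have "min (x / (128 * \<delta>)) (1 - x / (128 * \<delta>)) / 10 * norm (q - p) = min x (128 * \<delta> - x) / 10"
    using delta_pos by (simp add: dist_pq min_def field_simps)
  moreover have "x / (128 * \<delta>) \<in> {0..1}"
  proof -
    have "0 \<le> min x (128 * \<delta> - x)"
      using bound norm_ge_zero[of "y + r"] by argo
    then show ?thesis using delta_pos by simp
  qed
  ultimately show "z \<in> diamond p q"
    unfolding diamond_def using bound by (intro CollectI bexI[of _ "x / (128 * \<delta>)"]) auto
qed

text \<open>A positive label occurs at a single vertex, and nonadjacent edges share no vertex. So a
  common label is 0, which the middle part has only at its two ends.\<close>

lemma label_coincidence:
  assumes "29 \<le> i" "Suc i < j" "j + 30 \<le> n"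
    and "a = c i \<or> a = c (Suc i)" "a = c j \<or> a = c (Suc j)"
  shows "i \<le> 30" "n \<le> j + 31"
  using assms n_ge by (auto simp: c_def split: if_splits)

text \<open>It suffices to find a unit vector on which the foot points differ by
  \<open>3/10 * \<delta>\<close>, since the radii cost at most half of that. The direction
  \<open>e\<close> serves if the edges are far apart along the segment; otherwise \<open>dx\<close>
  is small, hence \<open>h\<close> large, and an axis \<open>u a\<close> serves.\<close>

lemma nonadjacent_separated:
  assumes "Suc i < j" "j < n"
    and "z \<in> diamond (P i) (P (Suc i))" "z' \<in> diamond (P j) (P (Suc j))"
  shows "norm (z' - z) \<ge> \<delta> / 10"
proof -
  obtain s r where s: "0 \<le> s" "s \<le> 1" and r: "norm r \<le> min s (1 - s) / 10 * len i"
    and z: "z = p + ((1 - s) * X i + s * X (Suc i)) *\<^sub>R e + ((1 - s) *\<^sub>R Y i + s *\<^sub>R Y (Suc i)) + r"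
    using assms(3) by (rule diamond_P_E) (use assms in auto)
  obtain t r' where t: "0 \<le> t" "t \<le> 1" and r': "norm r' \<le> min t (1 - t) / 10 * len j"
    and z': "z' = p + ((1 - t) * X j + t * X (Suc j)) *\<^sub>R e + ((1 - t) *\<^sub>R Y j + t *\<^sub>R Y (Suc j)) + r'"
    using assms(4) by (rule diamond_P_E) (use assms in auto)
  have half: "min s (1 - s) \<le> 1/2" for s :: real
    by (simp add: min_def)
  \<comment> \<open>Edge \<open>i\<close> is not the last one, so its length is
    \<open>\<delta>\<close>; edge \<open>j\<close> may have length
    \<open>\<epsilon>\<close>.\<close>
  have "norm r \<le> 1 / 2 / 10 * \<delta>"
    using assms delta_pos by (intro order_trans[OF r] mult_mono divide_right_mono half) (auto simp: len_def)
  moreover have "norm r' \<le> 1 / 2 / 10 * (2 * \<delta>)"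
    using len[of j] by (intro order_trans[OF r'] mult_mono divide_right_mono half) auto
  ultimately have rr: "norm (r' - r) \<le> 3 / 20 * \<delta>"
    using norm_triangle_ineq4[of r' r] by simp
  have far: "norm (z' - z) \<ge> \<delta> / 10"
    if w: "norm w = 1" "\<bar>(z' - z - (r' - r)) \<bullet> w\<bar> \<ge> 3 / 10 * \<delta>" for w
  proof -
    have "3 / 10 * \<delta> \<le> norm (z' - z - (r' - r))"
      using Cauchy_Schwarz_ineq2[of "z' - z - (r' - r)" w] w by simp
    then show ?thesis
      using norm_triangle_ineq4[of "z' - z" "r' - r"] rr delta_pos by simp
  qed
  have mono: "X i \<le> X (Suc i)" "X j \<le> X (Suc j)"
    using X_mono assms by auto
  have far_X: "norm (z' - z) \<ge> \<delta> / 10" if X: "X j - X (Suc i) \<ge> 3 / 10 * \<delta>"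
  proof (rule far[of e])
    have "(z' - z - (r' - r)) \<bullet> e = ((1 - t) * X j + t * X (Suc j)) - ((1 - s) * X i + s * X (Suc i))"
      unfolding z z' using assms by (simp add: inner_add inner_diff e)
    moreover have "(1 - t) * X j + t * X (Suc j) = X j + t * (X (Suc j) - X j)"
        "(1 - s) * X i + s * X (Suc i) = X (Suc i) - (1 - s) * (X (Suc i) - X i)"
      by (simp_all add: algebra_simps)
    moreover have "0 \<le> t * (X (Suc j) - X j)" "0 \<le> (1 - s) * (X (Suc i) - X i)"
      using s t mono by simp_all
    ultimately show "\<bar>(z' - z - (r' - r)) \<bullet> e\<bar> \<ge> 3 / 10 * \<delta>"
      using X by linarith
  qed (simp add: e)
  have X_gap: "X j - X (Suc i) \<ge> X (Suc m) - X m" if "Suc i \<le> m" "m < j" for m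
    using X_mono[of "Suc i" m] X_mono[of "Suc m" j] assms that by simp
  \<comment> \<open>In the second and third cases a whole straight edge lies between the two
    edges.\<close>
  consider "dx \<ge> 3 / 10 * \<delta>" | "i < 29" | "n < j + 30" | "dx < 3 / 10 * \<delta>" "29 \<le> i" "j + 30 \<le> n"
    by linarith
  then show ?thesis
  proof cases
    case 1
    then show ?thesis
      using X_gap[of "Suc i"] X_step_ge[of "Suc i"] assms by (intro far_X) auto
  next
    case 2
    then show ?thesis
      using X_gap[of "Suc i"] X_step[of "Suc i"] assms len(1)[of "Suc i"] delta_pos
      by (intro far_X) (auto simp: straight_def)
  next
    case 3
    then obtain m where m: "j = Suc m"
      using assms by (cases j) auto
    show ?thesis
      using 3 m X_gap[of m] X_step[of m] assms len(1)[of m] delta_pos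
      by (intro far_X) (auto simp: straight_def)
  next
    case 4
    \<comment> \<open>The axis of the nearer end of edge \<open>i\<close> carries at least half the
      weight. If edge \<open>j\<close> uses it too, the edges lie at opposite ends of the middle
      part and \<open>e\<close> separates them.\<close>
    define a where "a = (if s \<le> 1/2 then c i else c (Suc i))"
    have a: "a < n"
      using c_less[of i] c_less[of "Suc i"] assms by (simp add: a_def)
    show ?thesis
    proof (cases "a = c j \<or> a = c (Suc j)")
      case True
      then have ij: "i \<le> 30" "n \<le> j + 31"
        using label_coincidence[of i j a] 4 assms(1) by (auto simp: a_def)
      have "\<not> n - 31 \<le> 30" "31 + 30 \<le> n"
        using n_ge by simp_all
      then have "X (n - 31) = 30 * \<delta> + (real n - 61) * dx" "X 31 = 30 * \<delta> + dx"
        by (simp_all add: X_def of_nat_diff algebra_simps)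
      then have "X (n - 31) - X 31 = 69 * \<delta> - \<epsilon> - 2 * dx"
        unfolding dx(3)[symmetric] by (simp add: algebra_simps)
      moreover have "X (n - 31) \<le> X j" "X (Suc i) \<le> X 31"
        using ij assms n_ge by (auto intro!: X_mono)
      ultimately show ?thesis
        using 4 ell delta_pos by (intro far_X) linarith
    next
      case False
      have "\<bar>(z' - z - (r' - r)) \<bullet> u a\<bar> \<ge> h / 2"
      proof -
        define wt where "wt = (1 - s) * (if c i = a then 1 else 0) + s * (if c (Suc i) = a then 1 else 0)"
        have "wt \<ge> 1/2"
          using s by (auto simp: wt_def a_def)
        have "(z' - z - (r' - r)) \<bullet> u a = - (h * wt)"
          unfolding z z' wt_def using assms a False
          by (simp add: inner_add_left inner_diff_left e inner_Y_u) (simp add: algebra_simps)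
        moreover have "h * wt \<ge> h * (1/2)"
          using \<open>wt \<ge> 1/2\<close> h by (intro mult_left_mono) auto
        ultimately show ?thesis by simp
      qed
      moreover have "h \<ge> 6 / 10 * \<delta>"
      proof (rule power2_le_imp_le)
        have "dx\<^sup>2 \<le> (3 / 10 * \<delta>)\<^sup>2"
          using 4 dx(1) by (intro power_mono) auto
        then have "dx\<^sup>2 \<le> 9 / 100 * \<delta>\<^sup>2"
          by (simp add: power_mult_distrib power2_eq_square)
        moreover have "0 \<le> \<delta>\<^sup>2" by simp
        ultimately have "36 / 100 * \<delta>\<^sup>2 \<le> h\<^sup>2"
          unfolding h(2) by argo
        then show "(6 / 10 * \<delta>)\<^sup>2 \<le> h\<^sup>2"
          by (simp add: power_mult_distrib power2_eq_square)
      qed (rule h)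
      ultimately show ?thesis
        using a orthonormal[of a a] by (intro far[of "u a"]) (auto simp: norm_eq_1)
    qed
  qed
qed

lemma P_mem_subspace:
  assumes "subspace S" "p \<in> S" "q \<in> S" "\<And>i. i < n \<Longrightarrow> u i \<in> S" "i \<le> n"
  shows "P i \<in> S"
  unfolding P_def Y_def e_def using assms c_less[of i] zero_less_n
  by (intro subspace_add subspace_scale subspace_diff) auto

end

section \<open>Iterated subdivision\<close>

text \<open>The arc enters through the diameter function \<open>D\<close> of its subarcs alone:
  doubling becomes \<open>packing\<close>, and the room for zigzags is \<open>frame\<close>.\<close>

locale arc_distance =
  fixes D :: "real \<Rightarrow> real \<Rightarrow> real" and M :: nat and S :: "'e::real_inner set"
  assumes D_refl: "0 \<le> t \<Longrightarrow> t \<le> 1 \<Longrightarrow> D t t = 0"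
    and D_pos: "0 \<le> s \<Longrightarrow> s < t \<Longrightarrow> t \<le> 1 \<Longrightarrow> 0 < D s t"
    and D_mono: "0 \<le> s' \<Longrightarrow> s' \<le> s \<Longrightarrow> s \<le> t \<Longrightarrow> t \<le> t' \<Longrightarrow> t' \<le> 1 \<Longrightarrow> D s t \<le> D s' t'"
    and D_triangle: "0 \<le> s \<Longrightarrow> s \<le> t \<Longrightarrow> t \<le> v \<Longrightarrow> v \<le> 1 \<Longrightarrow> D s v \<le> D s t + D t v"
    and D_continuous: "0 \<le> s \<Longrightarrow> s \<le> 1 \<Longrightarrow> continuous_on {s..1} (D s)"
    and packing: "\<And>\<tau> n. 0 \<le> \<tau> 0 \<Longrightarrow> \<tau> n \<le> 1 \<Longrightarrow> (\<And>i. i < n \<Longrightarrow> \<tau> i < \<tau> (Suc i)) \<Longrightarrow>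
      (\<And>i. i < n \<Longrightarrow> D (\<tau> 0) (\<tau> n) \<le> 128 * D (\<tau> i) (\<tau> (Suc i))) \<Longrightarrow> n \<le> M"
    and subspace_S: "subspace S" and complete_S: "complete S"
    and frame: "\<And>v. v \<in> S \<Longrightarrow> \<exists>u. (\<forall>i<M. u i \<in> S \<and> u i \<bullet> v = 0) \<and>
      (\<forall>i<M. \<forall>j<M. u i \<bullet> u j = (if i = j then 1 else 0))"
begin

lemma M_pos: "0 < M"
proof -
  have "1 \<le> M"
    \<comment> \<open>The chain is the one-piece chain from 0 to 1.\<close>
    by (rule packing[of real]) (use D_pos[of 0 1] in auto)
  then show ?thesis by simp
qed

lemma chain_mono:
  fixes \<tau> :: "nat \<Rightarrow> real"
  assumes "\<And>i. i < n \<Longrightarrow> \<tau> i < \<tau> (Suc i)" "i \<le> j" "j \<le> n"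
  shows "\<tau> i \<le> \<tau> j"
  using assms(2,3)
proof (induction rule: dec_induct)
  case (step m)
  then show ?case using assms(1)[of m] by simp
qed simp

section \<open>Cutting a subarc into pieces\<close>

definition partition :: "real \<Rightarrow> real \<Rightarrow> nat \<Rightarrow> (nat \<Rightarrow> real) \<Rightarrow> bool" where
  "partition a b n \<tau> \<longleftrightarrow> 0 < n \<and> \<tau> 0 = a \<and> \<tau> n = b \<and> (\<forall>i<n. \<tau> i < \<tau> (Suc i)) \<and>
     (\<forall>i. Suc i < n \<longrightarrow> D (\<tau> i) (\<tau> (Suc i)) = D a b / 128) \<and>
     D (\<tau> (n - 1)) b \<in> {D a b / 128..D a b / 64}"

text \<open>Pieces of diameter exactly \<open>\<delta>\<close> are cut off by the intermediate value
  theorem until the remainder is at most \<open>2 * \<delta>\<close>. If this never stopped,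
  \<open>Suc M\<close> pieces would contradict \<open>packing\<close>.\<close>

lemma ex_partition:
  assumes ab: "0 \<le> a" "a < b" "b \<le> 1"
  shows "\<exists>n \<tau>. partition a b n \<tau>"
proof (rule ccontr)
  assume no: "\<not> ?thesis"
  define \<delta> where "\<delta> = D a b / 128"
  have \<delta>: "0 < \<delta>" "D a b = 128 * \<delta>"
    using D_pos[of a b] ab by (simp_all add: \<delta>_def)
  have "\<exists>\<tau>. \<tau> 0 = a \<and> \<tau> m < b \<and> (\<forall>i<m. \<tau> i < \<tau> (Suc i) \<and> D (\<tau> i) (\<tau> (Suc i)) = \<delta>) \<and> \<delta> \<le> D (\<tau> m) b" for m
  proof (induction m)
    case 0
    then show ?case using ab \<delta> by (intro exI[of _ "\<lambda>_. a"]) auto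
  next
    case (Suc m)
    then obtain \<tau> where \<tau>: "\<tau> 0 = a" "\<tau> m < b" "\<And>i. i < m \<Longrightarrow> \<tau> i < \<tau> (Suc i)"
        "\<And>i. i < m \<Longrightarrow> D (\<tau> i) (\<tau> (Suc i)) = \<delta>" "\<delta> \<le> D (\<tau> m) b"
      by blast
    have "a \<le> \<tau> m"
      using chain_mono[of m \<tau> 0 m] \<tau> by simp
    show ?case
    proof (cases "D (\<tau> m) b \<le> 2 * \<delta>")
      case True
      define \<tau>' where "\<tau>' = \<tau>(Suc m := b)"
      have "partition a b (Suc m) \<tau>'"
        unfolding partition_def \<delta>_def[symmetric]
        using \<tau> True \<delta>(2) by (auto simp: \<tau>'_def less_Suc_eq)
      with no show ?thesis by blast
    next
      case False
      have "\<exists>t. \<tau> m \<le> t \<and> t \<le> b \<and> D (\<tau> m) t = \<delta>"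
        using D_refl[of "\<tau> m"] \<tau>(2) \<open>a \<le> \<tau> m\<close> ab False \<delta>(1)
        by (intro IVT' continuous_on_subset[OF D_continuous]) auto
      then obtain t where t: "\<tau> m \<le> t" "t \<le> b" "D (\<tau> m) t = \<delta>" by blast
      then have "\<tau> m \<noteq> t"
        using D_refl[of t] \<open>a \<le> \<tau> m\<close> ab \<delta>(1) by auto
      \<comment> \<open>A remainder above \<open>2 * \<delta>\<close> leaves more than
        \<open>\<delta>\<close> after the cut, so the last piece never becomes too short.\<close>
      have tb: "\<delta> < D t b"
        using D_triangle[of "\<tau> m" t b] t \<open>a \<le> \<tau> m\<close> ab False by simp
      then have "t \<noteq> b"
        using D_refl[of b] ab \<delta> by auto
      show ?thesis
        by (rule exI[of _ "\<tau>(Suc m := t)"])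
           (use \<tau> t tb \<open>t \<noteq> b\<close> \<open>\<tau> m \<noteq> t\<close> in \<open>auto simp: less_Suc_eq\<close>)
    qed
  qed
  then obtain \<tau> where \<tau>: "\<tau> 0 = a" "\<tau> (Suc M) < b" "\<And>i. i < Suc M \<Longrightarrow> \<tau> i < \<tau> (Suc i)"
      "\<And>i. i < Suc M \<Longrightarrow> D (\<tau> i) (\<tau> (Suc i)) = \<delta>"
    by blast
  have "a \<le> \<tau> (Suc M)"
    using chain_mono[of "Suc M" \<tau> 0 "Suc M"] \<tau> by simp
  then have "D a (\<tau> (Suc M)) \<le> 128 * \<delta>"
    using D_mono[of a a "\<tau> (Suc M)" b] \<tau>(2) ab \<delta> by simp
  then have "Suc M \<le> M"
    using \<tau> ab by (intro packing[of \<tau>]) auto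
  then show False by simp
qed

text \<open>Subadditivity along the pieces. It becomes \<open>total_length\<close>, which rules out
  a polygon too short to reach \<open>q\<close>.\<close>

lemma partition_length:
  assumes ab: "0 \<le> a" "b \<le> 1" and part: "partition a b n \<tau>"
  shows "D a b \<le> (real n - 1) * (D a b / 128) + D (\<tau> (n - 1)) b"
proof -
  have \<tau>: "\<tau> 0 = a" "\<tau> n = b" "\<And>i. i < n \<Longrightarrow> \<tau> i < \<tau> (Suc i)" "0 < n"
    using part by (auto simp: partition_def)
  have range: "a \<le> \<tau> i" "\<tau> i \<le> b" if "i \<le> n" for i
    using chain_mono[of n \<tau> 0 i] chain_mono[of n \<tau> i n] \<tau> that by auto
  have "m < n \<Longrightarrow> D a (\<tau> m) \<le> real m * (D a b / 128)" for m
  proof (induction m)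
    case 0
    then show ?case using \<tau> ab range[of 0] D_refl[of a] by simp
  next
    case (Suc m)
    then have "D (\<tau> m) (\<tau> (Suc m)) = D a b / 128"
      using part by (auto simp: partition_def)
    moreover have "D a (\<tau> (Suc m)) \<le> D a (\<tau> m) + D (\<tau> m) (\<tau> (Suc m))"
      using Suc.prems ab range[of m] range[of "Suc m"] \<tau>(3)[of m] by (intro D_triangle) auto
    ultimately show ?case using Suc by (simp add: algebra_simps)
  qed
  from this[of "n - 1"] have "D a (\<tau> (n - 1)) \<le> (real n - 1) * (D a b / 128)"
    using \<open>0 < n\<close> by (simp add: of_nat_diff)
  moreover have "D a b \<le> D a (\<tau> (n - 1)) + D (\<tau> (n - 1)) b"
    using range[of "n - 1"] ab by (intro D_triangle) auto
  ultimately show ?thesis by linarith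
qed

section \<open>The tree of subarcs and edges\<close>

type_synonym 'b node = "real \<times> real \<times> 'b \<times> 'b"

text \<open>Equality of edge length and diameter, not mere comparability, is what the children
  inherit without loss.\<close>

fun valid :: "'e node \<Rightarrow> bool" where
  "valid (a, b, p, q) \<longleftrightarrow> 0 \<le> a \<and> a < b \<and> b \<le> 1 \<and> p \<in> S \<and> q \<in> S \<and> norm (q - p) = D a b"

text \<open>What the limit argument takes over from the polygon, free of axes and offsets. The
  constant \<open>1280 = 128 * 10\<close> restates \<open>\<delta> / 10\<close>.\<close>

fun refines :: "'e node \<Rightarrow> nat \<times> (nat \<Rightarrow> real) \<times> (nat \<Rightarrow> 'e) \<Rightarrow> bool" where
  "refines (a, b, p, q) (n, \<tau>, P) \<longleftrightarrow>
     0 < n \<and> \<tau> 0 = a \<and> \<tau> n = b \<and> P 0 = p \<and> P n = q \<and>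
     (\<forall>i<n. \<tau> i < \<tau> (Suc i) \<and> valid (\<tau> i, \<tau> (Suc i), P i, P (Suc i)) \<and>
        D (\<tau> i) (\<tau> (Suc i)) \<in> {D a b / 128..D a b / 64} \<and>
        diamond (P i) (P (Suc i)) \<subseteq> diamond p q) \<and>
     (\<forall>i z z'. Suc i < n \<longrightarrow> z \<in> diamond (P i) (P (Suc i)) \<longrightarrow> z' \<in> diamond (P (Suc i)) (P (Suc (Suc i))) \<longrightarrow>
        (norm (z - P (Suc i)) + norm (z' - P (Suc i))) / 3 \<le> norm (z' - z)) \<and>
     (\<forall>i j z z'. Suc i < j \<longrightarrow> j < n \<longrightarrow> z \<in> diamond (P i) (P (Suc i)) \<longrightarrow> z' \<in> diamond (P j) (P (Suc j)) \<longrightarrow>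
        D a b / 1280 \<le> norm (z' - z))"

lemma ex_refines:
  assumes "valid \<nu>"
  shows "\<exists>k. refines \<nu> k"
proof -
  obtain a b p q where \<nu>: "\<nu> = (a, b, p, q)" by (cases \<nu>)
  with assms have ab: "0 \<le> a" "a < b" "b \<le> 1" and pq: "p \<in> S" "q \<in> S" "norm (q - p) = D a b"
    by auto
  obtain n \<tau> where part: "partition a b n \<tau>"
    using ex_partition[OF ab] by blast
  then have \<tau>: "\<tau> 0 = a" "\<tau> n = b" "\<And>i. i < n \<Longrightarrow> \<tau> i < \<tau> (Suc i)" "0 < n"
    by (auto simp: partition_def)
  have range: "a \<le> \<tau> i" "\<tau> i \<le> b" if "i \<le> n" for i
    using chain_mono[of n \<tau> 0 i] chain_mono[of n \<tau> i n] \<tau> that by auto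
  define \<delta> \<epsilon> where "\<delta> = D a b / 128" and "\<epsilon> = D (\<tau> (n - 1)) b"
  have \<delta>: "0 < \<delta>" "D a b = 128 * \<delta>"
    using D_pos[of a b] ab by (simp_all add: \<delta>_def)
  have \<epsilon>: "\<delta> \<le> \<epsilon>" "\<epsilon> \<le> 2 * \<delta>"
    using part by (auto simp: partition_def \<delta>_def \<epsilon>_def)
  have step: "D (\<tau> i) (\<tau> (Suc i)) = (if Suc i = n then \<epsilon> else \<delta>)" if "i < n" for i
    using part that by (auto simp: partition_def \<delta>_def \<epsilon>_def)
  \<comment> \<open>With at most \<open>M\<close> pieces, the \<open>M\<close> axes of
    \<open>frame\<close> suffice.\<close>
  have "n \<le> M"
    by (rule packing[of \<tau>]) (use \<tau> ab step \<delta> \<epsilon> in auto)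
  then obtain u where u: "\<And>i. i < n \<Longrightarrow> u i \<in> S" "\<And>i. i < n \<Longrightarrow> u i \<bullet> (q - p) = 0"
      "\<And>i j. i < n \<Longrightarrow> j < n \<Longrightarrow> u i \<bullet> u j = (if i = j then 1 else 0)"
    using frame[OF subspace_diff[OF subspace_S pq(2,1)]] by (metis order_less_le_trans)
  interpret zigzag p q \<delta> \<epsilon> n u
  proof
    show "128 * \<delta> \<le> (real n - 1) * \<delta> + \<epsilon>"
      using partition_length[OF ab(1,3) part] unfolding \<delta>_def \<epsilon>_def by simp
  qed (use \<delta> \<epsilon> pq(3) u in simp_all)
  have P_mem: "P i \<in> S" if "i \<le> n" for i
    using P_mem_subspace[OF subspace_S pq(1,2)] u that by blast
  have "refines \<nu> (n, \<tau>, P)"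
    unfolding \<nu> refines.simps
  proof (intro conjI allI impI)
    fix i assume i: "i < n"
    show "valid (\<tau> i, \<tau> (Suc i), P i, P (Suc i))"
      using i range[of i] range[of "Suc i"] ab \<tau>(3)[OF i] P_mem[of i] P_mem[of "Suc i"] norm_P_step[OF i] step[OF i]
      by (simp add: len_def)
    show "D (\<tau> i) (\<tau> (Suc i)) \<in> {D a b / 128..D a b / 64}"
      using step[OF i] \<epsilon> \<delta> by simp
    show "diamond (P i) (P (Suc i)) \<subseteq> diamond p q"
      using i by (rule diamond_P_subset)
  next
    fix i z z' assume "Suc i < n" "z \<in> diamond (P i) (P (Suc i))" "z' \<in> diamond (P (Suc i)) (P (Suc (Suc i)))"
    then show "(norm (z - P (Suc i)) + norm (z' - P (Suc i))) / 3 \<le> norm (z' - z)"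
      using P_angle by (intro adjacent_diamonds_separated) auto
  next
    fix i j z z' assume "Suc i < j" "j < n" "z \<in> diamond (P i) (P (Suc i))" "z' \<in> diamond (P j) (P (Suc j))"
    then show "D a b / 1280 \<le> norm (z' - z)"
      using nonadjacent_separated[of i j z z'] \<delta> by simp
  qed (use \<tau> P_0 P_n in auto)
  then show ?thesis by blast
qed

text \<open>A fixed choice per node, so that parameters with a common node follow the same
  polygon.\<close>

definition "refinement \<nu> = (SOME k. refines \<nu> k)"
definition "N \<nu> = fst (refinement \<nu>)"
definition "T \<nu> = fst (snd (refinement \<nu>))"
definition "Q \<nu> = snd (snd (refinement \<nu>))"

definition "lo \<nu> = fst \<nu>" for \<nu> :: "'e node"
definition "hi \<nu> = fst (snd \<nu>)" for \<nu> :: "'e node"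
definition "src \<nu> = fst (snd (snd \<nu>))" for \<nu> :: "'e node"
definition "tgt \<nu> = snd (snd (snd \<nu>))" for \<nu> :: "'e node"
definition "width \<nu> = D (lo \<nu>) (hi \<nu>)" for \<nu> :: "'e node"
definition "cell \<nu> = diamond (src \<nu>) (tgt \<nu>)" for \<nu> :: "'e node"
definition "child \<nu> i = (T \<nu> i, T \<nu> (Suc i), Q \<nu> i, Q \<nu> (Suc i))"

lemma child_simps [simp]:
  "lo (child \<nu> i) = T \<nu> i" "hi (child \<nu> i) = T \<nu> (Suc i)"
  "src (child \<nu> i) = Q \<nu> i" "tgt (child \<nu> i) = Q \<nu> (Suc i)"
  by (simp_all add: child_def lo_def hi_def src_def tgt_def)

lemma refines_refinement:
  assumes "valid \<nu>"
  shows "refines (lo \<nu>, hi \<nu>, src \<nu>, tgt \<nu>) (N \<nu>, T \<nu>, Q \<nu>)"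
  using someI_ex[OF ex_refines[OF assms]]
  by (simp add: refinement_def N_def T_def Q_def lo_def hi_def src_def tgt_def)

lemma validD:
  assumes "valid \<nu>"
  shows "0 \<le> lo \<nu>" "lo \<nu> < hi \<nu>" "hi \<nu> \<le> 1" "src \<nu> \<in> S" "tgt \<nu> \<in> S" "norm (tgt \<nu> - src \<nu>) = width \<nu>"
    "0 < width \<nu>"
proof -
  obtain a b p q where "\<nu> = (a, b, p, q)" by (cases \<nu>)
  with assms show "0 \<le> lo \<nu>" "lo \<nu> < hi \<nu>" "hi \<nu> \<le> 1" "src \<nu> \<in> S" "tgt \<nu> \<in> S"
      "norm (tgt \<nu> - src \<nu>) = width \<nu>" "0 < width \<nu>"
    using D_pos[of a b] by (auto simp: lo_def hi_def src_def tgt_def width_def)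
qed

context
  fixes \<nu> :: "'e node"
  assumes valid: "valid \<nu>"
begin

lemma refinement_ends: "0 < N \<nu>" "T \<nu> 0 = lo \<nu>" "T \<nu> (N \<nu>) = hi \<nu>" "Q \<nu> 0 = src \<nu>" "Q \<nu> (N \<nu>) = tgt \<nu>"
  using refines_refinement[OF valid] by auto

lemma T_mono: "i \<le> j \<Longrightarrow> j \<le> N \<nu> \<Longrightarrow> T \<nu> i \<le> T \<nu> j"
  using chain_mono[of "N \<nu>" "T \<nu>"] refines_refinement[OF valid] by auto

lemma valid_child: "i < N \<nu> \<Longrightarrow> valid (child \<nu> i)"
  using refines_refinement[OF valid] by (auto simp: child_def)

lemma width_child: "i < N \<nu> \<Longrightarrow> width \<nu> / 128 \<le> width (child \<nu> i) \<and> width (child \<nu> i) \<le> width \<nu> / 64"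
  using refines_refinement[OF valid] by (auto simp: width_def)

lemma cell_child: "i < N \<nu> \<Longrightarrow> cell (child \<nu> i) \<subseteq> cell \<nu>"
  using refines_refinement[OF valid] by (simp add: cell_def)

lemma adjacent_cells:
  "Suc i < N \<nu> \<Longrightarrow> z \<in> cell (child \<nu> i) \<Longrightarrow> z' \<in> cell (child \<nu> (Suc i)) \<Longrightarrow>
    (norm (z - Q \<nu> (Suc i)) + norm (z' - Q \<nu> (Suc i))) / 3 \<le> norm (z' - z)"
  using refines_refinement[OF valid] by (simp add: cell_def)

lemma nonadjacent_cells:
  "Suc i < j \<Longrightarrow> j < N \<nu> \<Longrightarrow> z \<in> cell (child \<nu> i) \<Longrightarrow> z' \<in> cell (child \<nu> j) \<Longrightarrow>
    width \<nu> / 1280 \<le> norm (z' - z)"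
  using refines_refinement[OF valid] unfolding cell_def width_def refines.simps child_simps by blast

lemma D_ge_between:
  "i < N \<nu> \<Longrightarrow> lo \<nu> \<le> x \<Longrightarrow> x \<le> T \<nu> i \<Longrightarrow> T \<nu> (Suc i) \<le> y \<Longrightarrow> y \<le> hi \<nu> \<Longrightarrow> width \<nu> / 128 \<le> D x y"
  using width_child[of i] D_mono[of x "T \<nu> i" "T \<nu> (Suc i)" y] validD[OF valid] T_mono[of i "Suc i"]
  by (simp add: width_def)

end

text \<open>A division point lies in two children; the least index sends it to the one on its
  left.\<close>

definition "idx x \<nu> = (LEAST i. x \<le> T \<nu> (Suc i))"

lemma idx:
  assumes "valid \<nu>" "lo \<nu> \<le> x" "x \<le> hi \<nu>"
  shows "idx x \<nu> < N \<nu>" "T \<nu> (idx x \<nu>) \<le> x" "x \<le> T \<nu> (Suc (idx x \<nu>))"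
proof -
  note ends = refinement_ends[OF assms(1)]
  have last: "x \<le> T \<nu> (Suc (N \<nu> - 1))"
    using ends assms(3) by simp
  then show "x \<le> T \<nu> (Suc (idx x \<nu>))"
    unfolding idx_def by (rule LeastI)
  have "idx x \<nu> \<le> N \<nu> - 1"
    unfolding idx_def using last by (rule Least_le)
  then show "idx x \<nu> < N \<nu>"
    using ends by simp
  show "T \<nu> (idx x \<nu>) \<le> x"
  proof (cases "idx x \<nu>")
    case 0
    then show ?thesis using ends assms(2) by simp
  next
    case (Suc i)
    then have "\<not> x \<le> T \<nu> (Suc i)"
      using not_less_Least[of i "\<lambda>i. x \<le> T \<nu> (Suc i)"] by (simp add: idx_def)
    then show ?thesis using Suc by simp
  qed
qed

section \<open>Branches and the limit curve\<close>

definition "top_node = (SOME \<nu>. valid \<nu> \<and> lo \<nu> = 0 \<and> hi \<nu> = 1)"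

lemma top_node: "valid top_node" "lo top_node = 0" "hi top_node = 1"
proof -
  have "(0::'e) \<in> S"
    by (rule subspace_0[OF subspace_S])
  from frame[OF this] obtain v where v: "v \<in> S" "v \<bullet> v = 1"
    using M_pos by auto
  let ?\<nu> = "(0, 1, 0, D 0 1 *\<^sub>R v) :: 'e node"
  have "norm v = 1"
    using v by (simp add: norm_eq_1)
  then have "valid ?\<nu> \<and> lo ?\<nu> = 0 \<and> hi ?\<nu> = 1"
    using v D_pos[of 0 1] \<open>0 \<in> S\<close> subspace_scale[OF subspace_S] by (simp add: lo_def hi_def)
  then have "valid top_node \<and> lo top_node = 0 \<and> hi top_node = 1"
    unfolding top_node_def by (rule someI)
  then show "valid top_node" "lo top_node = 0" "hi top_node = 1" by auto
qed

primrec branch :: "real \<Rightarrow> nat \<Rightarrow> 'e node" where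
  "branch x 0 = top_node"
| "branch x (Suc j) = child (branch x j) (idx x (branch x j))"

definition "curve x = lim (\<lambda>j. src (branch x j))"

context
  fixes x :: real
  assumes x: "0 \<le> x" "x \<le> 1"
begin

lemma branch: "valid (branch x j)" "lo (branch x j) \<le> x" "x \<le> hi (branch x j)"
proof -
  have "valid (branch x j) \<and> lo (branch x j) \<le> x \<and> x \<le> hi (branch x j)"
    using top_node x valid_child idx by (induction j) auto
  then show "valid (branch x j)" "lo (branch x j) \<le> x" "x \<le> hi (branch x j)" by auto
qed

lemmas idx_branch = idx[OF branch, of j for j]

lemma width_branch: "width (branch x j) \<le> width top_node * (1/64) ^ j"
proof (induction j)
  case (Suc j)
  then show ?case
    using width_child[OF branch(1) idx_branch(1), of j] by simp
qed simp

lemma width_branch_tendsto: "(\<lambda>j. width (branch x j)) \<longlonglongrightarrow> 0"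
proof (rule tendsto_sandwich[OF _ _ tendsto_const])
  show "(\<lambda>j. width top_node * (1/64) ^ j) \<longlonglongrightarrow> 0"
    by (intro tendsto_mult_right_zero LIMSEQ_power_zero) simp
  show "\<forall>\<^sub>F j in sequentially. width (branch x j) \<le> width top_node * (1/64) ^ j"
    using width_branch by simp
  show "\<forall>\<^sub>F j in sequentially. 0 \<le> width (branch x j)"
    using validD(7)[OF branch(1)] by (simp add: less_imp_le)
qed

lemma cell_branch_antimono: "j \<le> k \<Longrightarrow> cell (branch x k) \<subseteq> cell (branch x j)"
proof (induction rule: dec_induct)
  case (step k)
  then show ?case
    using cell_child[OF branch(1) idx_branch(1), of k] by auto
qed simp

lemma src_branch_mem_cell: "j \<le> k \<Longrightarrow> src (branch x k) \<in> cell (branch x j)"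
  using cell_branch_antimono[of j k] left_mem_diamond by (auto simp: cell_def)

lemma dist_cell_src: "z \<in> cell (branch x j) \<Longrightarrow> norm (z - src (branch x j)) \<le> 2 * width (branch x j)"
  using diamond_dist_left validD(6)[OF branch(1)] by (metis cell_def)

lemma dist_cell_tgt: "z \<in> cell (branch x j) \<Longrightarrow> norm (z - tgt (branch x j)) \<le> 2 * width (branch x j)"
  using diamond_dist_right validD(6)[OF branch(1)] by (metis cell_def)

lemma curve: "curve x \<in> S" "(\<lambda>j. src (branch x j)) \<longlonglongrightarrow> curve x"
proof -
  have "Cauchy (\<lambda>j. src (branch x j))"
  proof (rule CauchyI)
    fix r :: real assume "0 < r"
    \<comment> \<open>Two later vertices are each within two widths of
      \<open>src (branch x K)\<close>, hence the quarter.\<close>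
    then have "\<forall>\<^sub>F j in sequentially. width (branch x j) < r / 4"
      by (intro order_tendstoD(2)[OF width_branch_tendsto]) simp
    then obtain K where K: "width (branch x K) < r / 4"
      by (auto simp: eventually_sequentially)
    have "norm (src (branch x i) - src (branch x j)) < r" if "K \<le> i" "K \<le> j" for i j
      using dist_cell_src[OF src_branch_mem_cell[OF that(1)]] dist_cell_src[OF src_branch_mem_cell[OF that(2)]] K
        norm_triangle_ineq4[of "src (branch x i) - src (branch x K)" "src (branch x j) - src (branch x K)"]
      by simp
    then show "\<exists>K. \<forall>i\<ge>K. \<forall>j\<ge>K. norm (src (branch x i) - src (branch x j)) < r"
      by blast
  qed
  moreover have "\<forall>j. src (branch x j) \<in> S"
    using validD(4) branch(1) by blast
  ultimately obtain l where "l \<in> S" "(\<lambda>j. src (branch x j)) \<longlonglongrightarrow> l"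
    using complete_S unfolding complete_def by metis
  then show "curve x \<in> S" "(\<lambda>j. src (branch x j)) \<longlonglongrightarrow> curve x"
    by (simp_all add: curve_def limI)
qed

text \<open>All later vertices lie in the cell, which is closed.\<close>

lemma curve_mem_cell: "curve x \<in> cell (branch x j)"
proof (rule Lim_in_closed_set[OF _ _ _ curve(2)])
  show "closed (cell (branch x j))"
    unfolding cell_def by (rule closed_diamond)
  show "\<forall>\<^sub>F k in sequentially. src (branch x k) \<in> cell (branch x j)"
    using src_branch_mem_cell by (auto simp: eventually_sequentially)
qed simp

lemma curve_mem_cell_child: "curve x \<in> cell (child (branch x j) (idx x (branch x j)))"
  using curve_mem_cell[of "Suc j"] by simp

text \<open>
  If the branch of \<open>x\<close> leaves the first child at some stage, then \<open>curve x\<close> and \<open>x\<close> are both at the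
  distance of that scale from the left end. The error \<open>width (branch x (j + m))\<close> allows an induction on
  the number of stages still to be inspected and disappears in the limit.
\<close>

lemma dist_curve_src_upto:
  defines "E \<equiv> \<lambda>j. norm (curve x - src (branch x j))" and "d \<equiv> \<lambda>j. D (lo (branch x j)) x"
  shows "d j / 1280 - width (branch x (j + m)) \<le> E j \<and> E j \<le> 256 * d j + 2 * width (branch x (j + m))"
proof (induction m arbitrary: j)
  case 0
  \<comment> \<open>With no stage inspected, the error term alone covers both bounds.\<close>
  have d: "0 \<le> d j" "d j \<le> width (branch x j)"
    using D_mono[of "lo (branch x j)" "lo (branch x j)" x "hi (branch x j)"] D_mono[of x x x x]
      D_mono[of "lo (branch x j)" x x x] D_refl[of x] branch[of j] validD[OF branch(1), of j] x by (auto simp: d_def width_def)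
  moreover have "E j \<le> 2 * width (branch x j)"
    using dist_cell_src[OF curve_mem_cell] by (simp add: E_def)
  moreover have "0 \<le> E j"
    by (simp add: E_def)
  ultimately show ?case by simp
next
  case (Suc m)
  define \<nu> i where "\<nu> = branch x j" and "i = idx x \<nu>"
  have \<nu>: "valid \<nu>" "lo \<nu> \<le> x" "x \<le> hi \<nu>"
    using branch by (simp_all add: \<nu>_def)
  note ends = refinement_ends[OF \<nu>(1)]
  have i: "i < N \<nu>" "T \<nu> i \<le> x"
    using idx[OF \<nu>] by (simp_all add: i_def)
  have d: "d j \<le> width \<nu>"
    using D_mono[of "lo \<nu>" "lo \<nu>" x "hi \<nu>"] \<nu> validD[OF \<nu>(1)] by (simp add: d_def width_def \<nu>_def)
  have w: "0 < width (branch x k)" for k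
    using validD(7) branch(1) by blast
  show ?case
  proof (cases "i = 0")
    \<comment> \<open>Staying in the first child keeps the left end and its vertex, so the claim is
      that of the next stage.\<close>
    case True
    then have "lo (branch x (Suc j)) = lo \<nu>" "src (branch x (Suc j)) = src \<nu>"
      using ends by (simp_all add: i_def \<nu>_def)
    then show ?thesis
      using Suc.IH[of "Suc j"] by (simp add: E_def d_def \<nu>_def)
  next
    case False
    have src: "src \<nu> \<in> cell (child \<nu> 0)"
      using left_mem_diamond ends by (simp add: cell_def)
    have fx: "curve x \<in> cell (child \<nu> i)"
      using curve_mem_cell_child by (simp add: i_def \<nu>_def)
    have "width \<nu> / 1280 \<le> E j"
    proof (cases "i = 1")
      \<comment> \<open>The first edge, at least \<open>width \<nu> / 128\<close> long, separates
        \<open>src \<nu>\<close> from the vertex; a third of it exceeds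
        \<open>width \<nu> / 1280\<close>.\<close>
      case True
      then have "(norm (src \<nu> - Q \<nu> (Suc 0)) + norm (curve x - Q \<nu> (Suc 0))) / 3 \<le> E j"
        using adjacent_cells[OF \<nu>(1) _ src, of "curve x"] fx i by (simp add: E_def \<nu>_def)
      moreover have "norm (src \<nu> - Q \<nu> (Suc 0)) = width (child \<nu> 0)"
        using validD(6)[OF valid_child[OF \<nu>(1) ends(1)]] ends by (simp add: norm_minus_commute)
      ultimately show ?thesis
        using width_child[OF \<nu>(1) ends(1)] norm_ge_zero[of "curve x - Q \<nu> (Suc 0)"] validD(7)[OF \<nu>(1)] by argo
    next
      case False
      then show ?thesis
        using nonadjacent_cells[OF \<nu>(1) _ i(1) src fx] \<open>i \<noteq> 0\<close> by (simp add: E_def \<nu>_def)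
    qed
    moreover have "width \<nu> / 128 \<le> d j"
      using D_ge_between[OF \<nu>(1), of 0 "lo \<nu>" x] ends \<nu> T_mono[OF \<nu>(1), of "Suc 0" i] i False
      by (simp add: d_def \<nu>_def)
    moreover have "E j \<le> 2 * width \<nu>"
      using dist_cell_src[OF curve_mem_cell, of j] by (simp add: E_def \<nu>_def)
    ultimately show ?thesis
      using d w[of "j + Suc m"] by argo
  qed
qed

text \<open>The same argument at the right end, with the last child in place of the first. It serves
  the left one of two adjacent cells, whose target is the common vertex.\<close>

lemma dist_curve_tgt_upto:
  defines "E \<equiv> \<lambda>j. norm (curve x - tgt (branch x j))" and "d \<equiv> \<lambda>j. D x (hi (branch x j))"
  shows "d j / 1280 - width (branch x (j + m)) \<le> E j \<and> E j \<le> 256 * d j + 2 * width (branch x (j + m))"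
proof (induction m arbitrary: j)
  case 0
  have d: "0 \<le> d j" "d j \<le> width (branch x j)"
    using D_mono[of "lo (branch x j)" x "hi (branch x j)" "hi (branch x j)"]
      D_mono[of x x x "hi (branch x j)"] D_refl[of x] branch[of j] validD[OF branch(1), of j] x by (auto simp: d_def width_def)
  moreover have "E j \<le> 2 * width (branch x j)"
    using dist_cell_tgt[OF curve_mem_cell] by (simp add: E_def)
  moreover have "0 \<le> E j"
    by (simp add: E_def)
  ultimately show ?case by simp
next
  case (Suc m)
  define \<nu> i where "\<nu> = branch x j" and "i = idx x \<nu>"
  have \<nu>: "valid \<nu>" "lo \<nu> \<le> x" "x \<le> hi \<nu>"
    using branch by (simp_all add: \<nu>_def)
  note ends = refinement_ends[OF \<nu>(1)]
  have i: "i < N \<nu>" "x \<le> T \<nu> (Suc i)"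
    using idx[OF \<nu>] by (simp_all add: i_def)
  have d: "d j \<le> width \<nu>"
    using D_mono[of "lo \<nu>" x "hi \<nu>" "hi \<nu>"] \<nu> validD[OF \<nu>(1)] by (simp add: d_def width_def \<nu>_def)
  have w: "0 < width (branch x k)" for k
    using validD(7) branch(1) by blast
  show ?case
  proof (cases "Suc i = N \<nu>")
    case True
    then have "hi (branch x (Suc j)) = hi \<nu>" "tgt (branch x (Suc j)) = tgt \<nu>"
      using ends by (simp_all add: i_def \<nu>_def)
    then show ?thesis
      using Suc.IH[of "Suc j"] by (simp add: E_def d_def \<nu>_def)
  next
    case False
    obtain l where l: "N \<nu> = Suc l"
      using ends by (cases "N \<nu>") auto
    have tgt: "tgt \<nu> \<in> cell (child \<nu> l)"
      using right_mem_diamond ends l by (simp add: cell_def)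
    have fx: "curve x \<in> cell (child \<nu> i)"
      using curve_mem_cell_child by (simp add: i_def \<nu>_def)
    have "width \<nu> / 1280 \<le> E j"
    proof (cases "Suc i = l")
      case True
      then have "(norm (curve x - Q \<nu> l) + norm (tgt \<nu> - Q \<nu> l)) / 3 \<le> E j"
        using adjacent_cells[OF \<nu>(1) _ fx, of "tgt \<nu>"] tgt l by (simp add: E_def \<nu>_def norm_minus_commute)
      moreover have "norm (tgt \<nu> - Q \<nu> l) = width (child \<nu> l)"
        using validD(6)[OF valid_child[OF \<nu>(1), of l]] ends l by simp
      ultimately show ?thesis
        using width_child[OF \<nu>(1), of l, simplified l, OF lessI] norm_ge_zero[of "curve x - Q \<nu> l"] validD(7)[OF \<nu>(1)] by argo
    next
      case False
      then show ?thesis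
        using nonadjacent_cells[OF \<nu>(1) _ _ fx tgt] i l \<open>Suc i \<noteq> N \<nu>\<close> by (simp add: E_def \<nu>_def norm_minus_commute)
    qed
    moreover have "width \<nu> / 128 \<le> d j"
      using D_ge_between[OF \<nu>(1), of l x "hi \<nu>"] ends \<nu> T_mono[OF \<nu>(1), of "Suc i" l] i l False
      by (simp add: d_def \<nu>_def)
    moreover have "E j \<le> 2 * width \<nu>"
      using dist_cell_tgt[OF curve_mem_cell, of j] by (simp add: E_def \<nu>_def)
    ultimately show ?thesis
      using d w[of "j + Suc m"] by argo
  qed
qed

lemma squeeze_width_branch:
  fixes A B C :: real
  assumes "\<And>m. A - width (branch x (j + m)) \<le> B \<and> B \<le> C + 2 * width (branch x (j + m))"
  shows "A \<le> B" "B \<le> C"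
proof -
  have w: "(\<lambda>m. width (branch x (j + m))) \<longlonglongrightarrow> 0"
    using LIMSEQ_ignore_initial_segment[OF width_branch_tendsto, of j] by (simp add: add.commute)
  have "(\<lambda>m. A - width (branch x (j + m))) \<longlonglongrightarrow> A - 0"
    by (intro tendsto_intros w)
  then show "A \<le> B"
    using assms by (intro LIMSEQ_le_const2) auto
  have "(\<lambda>m. C + 2 * width (branch x (j + m))) \<longlonglongrightarrow> C + 2 * 0"
    by (intro tendsto_intros w)
  then show "B \<le> C"
    using assms by (intro LIMSEQ_le_const) auto
qed

lemmas dist_curve_src = squeeze_width_branch[OF dist_curve_src_upto]
lemmas dist_curve_tgt = squeeze_width_branch[OF dist_curve_tgt_upto]

end

text \<open>The first stage at which the branches part decides. For nonadjacent cells both sides are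
  comparable to the width; for adjacent cells they are compared through the common vertex, which
  costs the factor 3 in \<open>3840 = 3 * 1280\<close>. The factor 512 is \<open>4 * 128\<close> in
  the first case and \<open>2 * 256\<close> in the second.\<close>

lemma curve_bilipschitz:
  assumes "0 \<le> x" "x < y" "y \<le> 1"
  shows "D x y / 3840 \<le> norm (curve y - curve x)" "norm (curve y - curve x) \<le> 512 * D x y"
proof -
  have x: "0 \<le> x" "x \<le> 1" and y: "0 \<le> y" "y \<le> 1"
    using assms by auto
  \<comment> \<open>Branches that never part would put both points into subarcs of vanishing width,
    against \<open>D x y > 0\<close>.\<close>
  have "\<exists>j. branch x j = branch y j \<and> branch x (Suc j) \<noteq> branch y (Suc j)"
  proof (rule ccontr)
    assume no: "\<not> ?thesis"
    have "branch x j = branch y j" for j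
    proof (induction j)
      case (Suc j)
      with no show ?case by blast
    qed simp
    then have "D x y \<le> width (branch x j)" for j
      using branch[OF x, of j] branch[OF y, of j] validD[OF branch(1)[OF x], of j] assms
      unfolding width_def by (intro D_mono) auto
    then have "D x y \<le> 0"
      by (intro LIMSEQ_le_const[OF width_branch_tendsto[OF x]]) auto
    then show False
      using D_pos[OF assms] by simp
  qed
  then obtain j where j: "branch x j = branch y j" "branch x (Suc j) \<noteq> branch y (Suc j)"
    by blast
  define \<nu> i k where "\<nu> = branch x j" and "i = idx x \<nu>" and "k = idx y \<nu>"
  have \<nu>: "valid \<nu>" "lo \<nu> \<le> x" "x \<le> hi \<nu>" "lo \<nu> \<le> y" "y \<le> hi \<nu>" "branch y j = \<nu>"
    using branch[OF x, of j] branch[OF y, of j] j by (simp_all add: \<nu>_def)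
  have i: "i < N \<nu>" "T \<nu> i \<le> x" "x \<le> T \<nu> (Suc i)" and k: "k < N \<nu>" "T \<nu> k \<le> y" "y \<le> T \<nu> (Suc k)"
    using idx[OF \<nu>(1-3)] idx[OF \<nu>(1,4,5)] by (simp_all add: i_def k_def)
  have "i \<noteq> k"
    using j \<nu> by (auto simp: i_def k_def \<nu>_def)
  moreover have "\<not> k < i"
    using T_mono[OF \<nu>(1), of "Suc k" i] i k assms by auto
  ultimately have ik: "i < k" by simp
  have fx: "curve x \<in> cell (child \<nu> i)" and fy: "curve y \<in> cell (child \<nu> k)"
    using curve_mem_cell_child[OF x, of j] curve_mem_cell_child[OF y, of j] \<nu> by (simp_all add: i_def k_def \<nu>_def)
  have Dw: "D x y \<le> width \<nu>"
    using \<nu> validD[OF \<nu>(1)] assms unfolding width_def by (intro D_mono) auto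
  have "D x y / 3840 \<le> norm (curve y - curve x) \<and> norm (curve y - curve x) \<le> 512 * D x y"
  proof (cases "Suc i < k")
    case True
    have "width \<nu> / 1280 \<le> norm (curve y - curve x)"
      using nonadjacent_cells[OF \<nu>(1) True k(1) fx fy] .
    moreover have "width \<nu> / 128 \<le> D x y"
      using D_ge_between[OF \<nu>(1), of "Suc i" x y] T_mono[OF \<nu>(1), of "Suc (Suc i)" k] True i k \<nu> by simp
    moreover have "norm (curve y - curve x) \<le> 4 * width \<nu>"
      using dist_cell_src[OF x curve_mem_cell[OF x], of j] dist_cell_src[OF y curve_mem_cell[OF y], of j]
        norm_triangle_ineq4[of "curve y - src \<nu>" "curve x - src \<nu>"] \<nu> by (simp add: \<nu>_def)
    ultimately show ?thesis
      using Dw D_pos[OF assms] by argo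
  next
    case False
    with ik have k_eq: "k = Suc i" by simp
    define t P where "t = T \<nu> k" and "P = Q \<nu> k"
    have t: "x \<le> t" "t \<le> y"
      using i k k_eq by (simp_all add: t_def)
    have "hi (branch x (Suc j)) = t" "tgt (branch x (Suc j)) = P" "lo (branch y (Suc j)) = t" "src (branch y (Suc j)) = P"
      using \<nu> k_eq by (simp_all add: t_def P_def i_def k_def \<nu>_def)
    then have fx': "D x t / 1280 \<le> norm (curve x - P)" "norm (curve x - P) \<le> 256 * D x t"
      and fy': "D t y / 1280 \<le> norm (curve y - P)" "norm (curve y - P) \<le> 256 * D t y"
      using dist_curve_tgt[OF x, of "Suc j"] dist_curve_src[OF y, of "Suc j"] by auto
    have "(norm (curve x - P) + norm (curve y - P)) / 3 \<le> norm (curve y - curve x)"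
      using adjacent_cells[OF \<nu>(1) _ fx] fy k k_eq by (simp add: P_def)
    moreover have "norm (curve y - curve x) \<le> norm (curve y - P) + norm (curve x - P)"
      using norm_triangle_ineq4[of "curve y - P" "curve x - P"] by simp
    moreover have "D x y \<le> D x t + D t y" "D x t \<le> D x y" "D t y \<le> D x y"
      using assms t by (auto intro!: D_triangle D_mono)
    ultimately show ?thesis
      using fx' fy' by argo
  qed
  then show "D x y / 3840 \<le> norm (curve y - curve x)" "norm (curve y - curve x) \<le> 512 * D x y"
    by auto
qed

end

section \<open>Quasi-arcs\<close>

lemma diameter_Un_le:
  assumes S: "bounded S" "bounded T" and z: "z \<in> S" "z \<in> T"
  shows "diameter (S \<union> T) \<le> diameter S + diameter T"
proof -
  have ge: "0 \<le> diameter S" "0 \<le> diameter T"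
    using S by (auto intro: diameter_ge_0)
  have "dist x y \<le> diameter S + diameter T" if xy: "x \<in> S \<union> T" "y \<in> S \<union> T" for x y
  proof -
    note b = diameter_bounded_bound[OF S(1)] diameter_bounded_bound[OF S(2)]
    consider "x \<in> S" "y \<in> S" | "x \<in> T" "y \<in> T" | "x \<in> S" "y \<in> T" | "x \<in> T" "y \<in> S"
      using xy by blast
    then show ?thesis
    proof cases
      case 1
      then show ?thesis using b(1)[of x y] ge by simp
    next
      case 2
      then show ?thesis using b(2)[of x y] ge by simp
    next
      case 3
      then show ?thesis using b(1)[of x z] b(2)[of z y] dist_triangle[of x y z] z by simp
    next
      case 4
      then show ?thesis using b(2)[of x z] b(1)[of z y] dist_triangle[of x y z] z by simp
    qed
  qed
  then show ?thesis
    using z unfolding diameter_def[of "S \<union> T"] by (auto intro!: cSUP_least)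
qed

section \<open>Covers and packings in doubling spaces\<close>

lemma doubling_iterate:
  fixes X :: "'a::metric_space set"
  assumes N: "\<forall>x\<in>X. \<forall>r>0. \<exists>S. S \<subseteq> X \<and> finite S \<and> card S \<le> N \<and>
    ball x r \<inter> X \<subseteq> (\<Union>s\<in>S. ball s (r / 2) \<inter> X)"
    and x: "x \<in> X" "0 < r"
  shows "\<exists>S. S \<subseteq> X \<and> finite S \<and> card S \<le> N ^ j \<and> ball x r \<inter> X \<subseteq> (\<Union>s\<in>S. ball s (r / 2 ^ j))"
proof (induction j)
  case 0
  then show ?case
    using x by (intro exI[of _ "{x}"]) auto
next
  case (Suc j)
  then obtain S where S: "S \<subseteq> X" "finite S" "card S \<le> N ^ j" "ball x r \<inter> X \<subseteq> (\<Union>s\<in>S. ball s (r / 2 ^ j))"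
    by blast
  have "\<exists>U. \<forall>s\<in>S. U s \<subseteq> X \<and> finite (U s) \<and> card (U s) \<le> N \<and>
      ball s (r / 2 ^ j) \<inter> X \<subseteq> (\<Union>u\<in>U s. ball u (r / 2 ^ j / 2) \<inter> X)"
  proof (intro bchoice ballI)
    fix s assume "s \<in> S"
    then have "s \<in> X" "0 < r / 2 ^ j"
      using S(1) x(2) by auto
    then show "\<exists>U. U \<subseteq> X \<and> finite U \<and> card U \<le> N \<and>
        ball s (r / 2 ^ j) \<inter> X \<subseteq> (\<Union>u\<in>U. ball u (r / 2 ^ j / 2) \<inter> X)"
      using N by blast
  qed
  then obtain U where U: "\<And>s. s \<in> S \<Longrightarrow> U s \<subseteq> X \<and> finite (U s) \<and> card (U s) \<le> N \<and>
      ball s (r / 2 ^ j) \<inter> X \<subseteq> (\<Union>u\<in>U s. ball u (r / 2 ^ j / 2) \<inter> X)"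
    by blast
  show ?case
  proof (intro exI[of _ "\<Union>s\<in>S. U s"] conjI)
    show "(\<Union>s\<in>S. U s) \<subseteq> X" "finite (\<Union>s\<in>S. U s)"
      using U S by auto
    have "card (\<Union>s\<in>S. U s) \<le> (\<Sum>s\<in>S. card (U s))"
      by (rule card_UN_le[OF S(2)])
    also have "\<dots> \<le> (\<Sum>s\<in>S. N)"
      using U by (intro sum_mono) blast
    also have "\<dots> \<le> N ^ Suc j"
      using S(3) by simp
    finally show "card (\<Union>s\<in>S. U s) \<le> N ^ Suc j" .
    show "ball x r \<inter> X \<subseteq> (\<Union>u\<in>\<Union>s\<in>S. U s. ball u (r / 2 ^ Suc j))"
    proof
      fix y assume y: "y \<in> ball x r \<inter> X"
      then obtain s where s: "s \<in> S" "y \<in> ball s (r / 2 ^ j) \<inter> X"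
        using S(4) by blast
      then obtain u where "u \<in> U s" "y \<in> ball u (r / 2 ^ j / 2)"
        using U[OF s(1)] by blast
      with s(1) show "y \<in> (\<Union>u\<in>\<Union>s\<in>S. U s. ball u (r / 2 ^ Suc j))"
        by (auto simp: field_simps)
    qed
  qed
qed

text \<open>After \<open>j\<close> halvings the covering balls have diameter below the separation
  \<open>c * r\<close>, so each contains at most one point of \<open>Y\<close>.\<close>

lemma doubling_packing:
  fixes X :: "'a::metric_space set" and c :: real
  assumes "doubling X" "0 < c"
  shows "\<exists>M::nat. \<forall>x\<in>X. \<forall>r>0. \<forall>Y. Y \<subseteq> ball x r \<inter> X \<longrightarrow> (\<forall>y\<in>Y. \<forall>z\<in>Y. y \<noteq> z \<longrightarrow> c * r \<le> dist y z) \<longrightarrow>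
    finite Y \<and> card Y \<le> M"
proof -
  obtain N :: nat where N: "\<forall>x\<in>X. \<forall>r>0. \<exists>S. S \<subseteq> X \<and> finite S \<and> card S \<le> N \<and>
      ball x r \<inter> X \<subseteq> (\<Union>s\<in>S. ball s (r / 2) \<inter> X)"
    using assms(1) unfolding doubling_def by blast
  obtain j where j: "2 / c < 2 ^ j"
    using real_arch_pow[of 2 "2 / c"] by auto
  show ?thesis
  proof (intro exI[of _ "N ^ j"] ballI allI impI)
    fix x r Y
    assume x: "x \<in> X" and r: "(0::real) < r" and Y: "Y \<subseteq> ball x r \<inter> X"
      and sep: "\<forall>y\<in>Y. \<forall>z\<in>Y. y \<noteq> z \<longrightarrow> c * r \<le> dist y z"
    obtain S where S: "finite S" "card S \<le> N ^ j" "ball x r \<inter> X \<subseteq> (\<Union>s\<in>S. ball s (r / 2 ^ j))"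
      using doubling_iterate[OF N x r] by blast
    have "\<forall>y\<in>Y. \<exists>s\<in>S. dist s y < r / 2 ^ j"
      using Y S(3) by (force simp: subset_iff)
    then obtain h where h: "\<And>y. y \<in> Y \<Longrightarrow> h y \<in> S \<and> dist (h y) y < r / 2 ^ j"
      by metis
    have "inj_on h Y"
    proof (rule inj_onI, rule ccontr)
      fix y z assume yz: "y \<in> Y" "z \<in> Y" "h y = h z" "y \<noteq> z"
      have "c * r \<le> dist y z"
        using sep yz by blast
      also have "\<dots> < 2 * (r / 2 ^ j)"
        using h[OF yz(1)] h[OF yz(2)] yz(3) dist_triangle3[of y z "h y"] by simp
      also have "\<dots> < c * r"
        using j r \<open>0 < c\<close> by (simp add: field_simps)
      finally show False .
    qed
    moreover have "h ` Y \<subseteq> S"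
      using h by blast
    ultimately show "finite Y \<and> card Y \<le> N ^ j"
      using S by (meson card_inj_on_le inj_on_finite order_trans)
  qed
qed

text \<open>Real and imaginary parts alternate. The value 0 from \<open>2 * m\<close> on is what
  membership in \<open>Euclidean_space\<close> requires.\<close>

definition real_coordinates :: "nat \<Rightarrow> (nat \<Rightarrow>\<^sub>0 complex) \<Rightarrow> nat \<Rightarrow> real" where
  "real_coordinates m z k = (if 2 * m \<le> k then 0
     else (if even k then Re else Im) (Poly_Mapping.lookup z (k div 2)))"

lemma eucl_dist_real_coordinates:
  assumes "z \<in> supported_below m" "w \<in> supported_below m"
  shows "eucl_dist (2 * m) (real_coordinates m z) (real_coordinates m w) = norm (z - w)"
proof -
  define g where "g k = (if even k then Re else Im) (Poly_Mapping.lookup (z - w) (k div 2))" for k :: nat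
  have "(\<Sum>k<2 * m. (real_coordinates m z k - real_coordinates m w k)\<^sup>2) = (\<Sum>k<2 * m. (g k)\<^sup>2)"
    by (intro sum.cong) (auto simp: g_def real_coordinates_def lookup_minus)
  also have "\<dots> = (\<Sum>k<m. Poly_Mapping.lookup (z - w) k \<bullet> Poly_Mapping.lookup (z - w) k)"
    by (induction m) (simp_all add: g_def inner_complex_def power2_eq_square)
  also have "\<dots> = (z - w) \<bullet> (z - w)"
    by (rule inner_supported_below[symmetric]) (intro subspace_diff subspace_supported_below assms)
  finally show ?thesis
    by (simp add: eucl_dist_def L2_set_def norm_eq_sqrt_inner)
qed

text \<open>Pulled back to the parameters, the continuum is a connected set of reals and contains
  the interval from \<open>s\<close> to \<open>t\<close>; so the continuum contains the
  subarc.\<close>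

lemma bounded_turning_arc:
  fixes X :: "'a::metric_space set"
  assumes hom: "homeomorphism {0..1::real} X \<gamma> \<gamma>'" and "bounded_turning X"
  obtains C where "1 \<le> C"
    "\<And>s t. 0 \<le> s \<Longrightarrow> s \<le> t \<Longrightarrow> t \<le> 1 \<Longrightarrow> diameter (\<gamma> ` {s..t}) \<le> C * dist (\<gamma> s) (\<gamma> t)"
proof -
  obtain C where C: "\<forall>x\<in>X. \<forall>y\<in>X. \<exists>K. K \<subseteq> X \<and> compact K \<and> connected K \<and>
      x \<in> K \<and> y \<in> K \<and> diameter K \<le> C * dist x y"
    using assms(2) unfolding bounded_turning_def by blast
  \<comment> \<open>The maximum keeps the constant at least 1, so that it can be divided by later
    on.\<close>
  show thesis
  proof (rule that[of "max 1 C"])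
    fix s t :: real assume st: "0 \<le> s" "s \<le> t" "t \<le> 1"
    then have "\<gamma> s \<in> X" "\<gamma> t \<in> X"
      using homeomorphism_image1[OF hom] by auto
    then obtain K where K: "K \<subseteq> X" "compact K" "connected K" "\<gamma> s \<in> K" "\<gamma> t \<in> K"
        "diameter K \<le> C * dist (\<gamma> s) (\<gamma> t)"
      using C by blast
    have "connected (\<gamma>' ` K)"
      using K continuous_on_subset[OF homeomorphism_cont2[OF hom]] by (intro connected_continuous_image) auto
    moreover have "s \<in> \<gamma>' ` K" "t \<in> \<gamma>' ` K"
      using K(4,5) st homeomorphism_apply1[OF hom] by (metis atLeastAtMost_iff image_eqI order_trans)+
    ultimately have "{s..t} \<subseteq> \<gamma>' ` K"
      by (rule connected_contains_Icc)
    then have "\<gamma> ` {s..t} \<subseteq> \<gamma> ` \<gamma>' ` K"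
      by (rule image_mono)
    also have "\<dots> \<subseteq> K"
      using K(1) homeomorphism_apply2[OF hom] by auto
    finally have "diameter (\<gamma> ` {s..t}) \<le> diameter K"
      using K(2) by (intro diameter_subset compact_imp_bounded)
    also have "\<dots> \<le> max 1 C * dist (\<gamma> s) (\<gamma> t)"
      using K(6) by (rule order_trans) (auto intro!: mult_right_mono)
    finally show "diameter (\<gamma> ` {s..t}) \<le> max 1 C * dist (\<gamma> s) (\<gamma> t)" .
  qed simp
qed

theorem proposition1p7:
  fixes X :: "'a::metric_space set"
  assumes "quasi_arc X"
  shows "\<exists>(n::nat) f. bilipschitz_embedding X n f"
proof -
  obtain \<gamma> \<gamma>' where hom: "homeomorphism {0..1::real} X \<gamma> \<gamma>'"
    using assms homeomorphic_sym unfolding quasi_arc_def homeomorphic_def by metis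
  have cont: "continuous_on {0..1} \<gamma>" and \<gamma>_mem: "\<And>t. 0 \<le> t \<Longrightarrow> t \<le> 1 \<Longrightarrow> \<gamma> t \<in> X"
    using homeomorphism_cont1[OF hom] homeomorphism_image1[OF hom] by auto
  obtain C where C: "1 \<le> C"
      "\<And>s t. 0 \<le> s \<Longrightarrow> s \<le> t \<Longrightarrow> t \<le> 1 \<Longrightarrow> diameter (\<gamma> ` {s..t}) \<le> C * dist (\<gamma> s) (\<gamma> t)"
    using bounded_turning_arc[OF hom] assms unfolding quasi_arc_def by blast
  define D where "D s t = diameter (\<gamma> ` {s..t})" for s t
  note turning = C(2)[folded D_def]
  have bdd: "bounded (\<gamma> ` {s..t})" if "0 \<le> s" "t \<le> 1" for s t
    using that by (intro compact_imp_bounded compact_continuous_image continuous_on_subset[OF cont]) auto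
  have dist_le: "dist (\<gamma> s) (\<gamma> t) \<le> D s t" if "0 \<le> s" "s \<le> t" "t \<le> 1" for s t
    unfolding D_def using that by (intro diameter_bounded_bound bdd) auto
  have mono: "D s t \<le> D s' t'" if "0 \<le> s'" "s' \<le> s" "s \<le> t" "t \<le> t'" "t' \<le> 1" for s s' t t'
    unfolding D_def using that by (intro diameter_subset bdd image_mono) auto
  have triangle: "D s v \<le> D s t + D t v" if "0 \<le> s" "s \<le> t" "t \<le> v" "v \<le> 1" for s t v
  proof -
    have "\<gamma> ` {s..v} = \<gamma> ` {s..t} \<union> \<gamma> ` {t..v}"
      using that by (simp add: image_Un[symmetric] ivl_disj_un_two_touch)
    then show ?thesis
      unfolding D_def using that by (simp add: diameter_Un_le[OF bdd bdd, of _ _ _ _ "\<gamma> t"])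
  qed
  have pos: "0 < D s t" if "0 \<le> s" "s < t" "t \<le> 1" for s t
  proof -
    have "\<gamma> s \<noteq> \<gamma> t"
      using that homeomorphism_apply1[OF hom, of s] homeomorphism_apply1[OF hom, of t] by auto
    then have "0 < dist (\<gamma> s) (\<gamma> t)" by simp
    also have "\<dots> \<le> D s t"
      using that by (intro dist_le) auto
    finally show ?thesis .
  qed
  have D_cont: "continuous_on {s..1} (D s)" if s: "0 \<le> s" "s \<le> 1" for s
    unfolding continuous_on_iff
  proof (intro ballI allI impI)
    fix t \<epsilon> :: real assume t: "t \<in> {s..1}" and "0 < \<epsilon>"
    then obtain d where d: "0 < d" "\<And>t'. t' \<in> {0..1} \<Longrightarrow> dist t' t < d \<Longrightarrow> dist (\<gamma> t') (\<gamma> t) < \<epsilon> / C"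
      using cont[unfolded continuous_on_iff, rule_format, of t "\<epsilon> / C"] s C(1) by auto
    have "dist (D s t') (D s t) < \<epsilon>" if t': "t' \<in> {s..1}" "dist t' t < d" for t'
    proof -
      \<comment> \<open>The change of \<open>D s\<close> is at most the diameter of the subarc
        between \<open>t\<close> and \<open>t'\<close>, which bounded turning controls by the
        distance of its ends.\<close>
      have "\<bar>D s t' - D s t\<bar> \<le> C * dist (\<gamma> t') (\<gamma> t)"
      proof (cases "t \<le> t'")
        case True
        then show ?thesis
          using triangle[of s t t'] mono[of s s t t'] turning[of t t'] t t' s by (simp add: dist_commute)
      next
        case False
        then show ?thesis
          using triangle[of s t' t] mono[of s s t' t] turning[of t' t] t t' s by simp
      qed
      also have "\<dots> < \<epsilon>"
        using d(2)[of t'] t' s C(1) by (simp add: field_simps)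
      finally show ?thesis
        by (simp add: dist_real_def)
    qed
    with d(1) show "\<exists>d>0. \<forall>t'\<in>{s..1}. dist t' t < d \<longrightarrow> dist (D s t') (D s t) < \<epsilon>"
      by blast
  qed
  \<comment> \<open>Division points of a subarc of diameter \<open>R\<close> will be separated by at
    least \<open>R / (128 * C)\<close>. They lie in an open ball of radius \<open>2 * R\<close>, so
    the ratio to the radius is \<open>1 / (256 * C)\<close>.\<close>
  obtain M where M: "\<And>x r Y. x \<in> X \<Longrightarrow> 0 < r \<Longrightarrow> Y \<subseteq> ball x r \<inter> X \<Longrightarrow>
      (\<And>y z. y \<in> Y \<Longrightarrow> z \<in> Y \<Longrightarrow> y \<noteq> z \<Longrightarrow> 1 / (256 * C) * r \<le> dist y z) \<Longrightarrow> card Y \<le> M"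
    using doubling_packing[of X "1 / (256 * C)"] assms C(1) unfolding quasi_arc_def by (auto, metis)
  have packing: "n \<le> M"
    if \<tau>: "0 \<le> \<tau> 0" "\<tau> n \<le> 1" "\<And>i. i < n \<Longrightarrow> \<tau> i < \<tau> (Suc i)"
      "\<And>i. i < n \<Longrightarrow> D (\<tau> 0) (\<tau> n) \<le> 128 * D (\<tau> i) (\<tau> (Suc i))" for \<tau> :: "nat \<Rightarrow> real" and n
  proof (cases "n = 0")
    case False
    have strict: "\<tau> i < \<tau> k" if "i < k" "k \<le> n" for i k
      using that
    proof (induction rule: strict_inc_induct)
      case (base i)
      then show ?case using \<tau>(3)[of i] by simp
    next
      case (step i)
      then show ?case using \<tau>(3)[of i] by simp
    qed
    have le: "\<tau> i \<le> \<tau> k" if "i \<le> k" "k \<le> n" for i k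
      using strict[of i k] that by (cases "i = k") auto
    have range: "0 \<le> \<tau> i" "\<tau> i \<le> 1" if "i \<le> n" for i
      using le[of 0 i] le[of i n] that \<tau> by auto
    define R where "R = D (\<tau> 0) (\<tau> n)"
    have R: "0 < R"
      unfolding R_def using \<tau> strict[of 0 n] False by (intro pos) auto
    have sep: "1 / (256 * C) * (2 * R) \<le> dist (\<gamma> (\<tau> i)) (\<gamma> (\<tau> k))" if "i < k" "k < n" for i k
    proof -
      have "R \<le> 128 * D (\<tau> i) (\<tau> (Suc i))"
        using \<tau>(4)[of i] that by (simp add: R_def)
      also have "D (\<tau> i) (\<tau> (Suc i)) \<le> D (\<tau> i) (\<tau> k)"
        using that range le[of i "Suc i"] le[of "Suc i" k] by (intro mono) auto
      also have "\<dots> \<le> C * dist (\<gamma> (\<tau> i)) (\<gamma> (\<tau> k))"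
        using that range le by (intro turning) auto
      finally show ?thesis
        using C(1) by (simp add: field_simps)
    qed
    have sep': "1 / (256 * C) * (2 * R) \<le> dist (\<gamma> (\<tau> i)) (\<gamma> (\<tau> k))" if "i \<noteq> k" "i < n" "k < n" for i k
      using sep[of i k] sep[of k i] that by (cases "i < k") (auto simp: dist_commute)
    have "inj_on (\<lambda>i. \<gamma> (\<tau> i)) {..<n}"
    proof (rule inj_onI, rule ccontr)
      fix i k assume "i \<in> {..<n}" "k \<in> {..<n}" "\<gamma> (\<tau> i) = \<gamma> (\<tau> k)" "i \<noteq> k"
      then show False
        using sep'[of i k] R C(1) by (simp add: divide_le_0_iff)
    qed
    then have "card ((\<lambda>i. \<gamma> (\<tau> i)) ` {..<n}) = n"
      by (simp add: card_image)
    moreover have "card ((\<lambda>i. \<gamma> (\<tau> i)) ` {..<n}) \<le> M"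
    proof (rule M)
      show "\<gamma> (\<tau> 0) \<in> X" "0 < 2 * R"
        using range[of 0] \<gamma>_mem R by auto
      have "dist (\<gamma> (\<tau> 0)) (\<gamma> (\<tau> i)) < 2 * R" if "i < n" for i
      proof -
        have "dist (\<gamma> (\<tau> 0)) (\<gamma> (\<tau> i)) \<le> D (\<tau> 0) (\<tau> i)"
          using that range le by (intro dist_le) auto
        also have "\<dots> \<le> R"
          unfolding R_def using that range le by (intro mono) auto
        finally show ?thesis using R by simp
      qed
      then show "(\<lambda>i. \<gamma> (\<tau> i)) ` {..<n} \<subseteq> ball (\<gamma> (\<tau> 0)) (2 * R) \<inter> X"
        using range \<gamma>_mem by auto
      fix y z assume "y \<in> (\<lambda>i. \<gamma> (\<tau> i)) ` {..<n}" "z \<in> (\<lambda>i. \<gamma> (\<tau> i)) ` {..<n}" "y \<noteq> z"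
      then obtain i k where "y = \<gamma> (\<tau> i)" "z = \<gamma> (\<tau> k)" "i < n" "k < n" "i \<noteq> k"
        by auto
      then show "1 / (256 * C) * (2 * R) \<le> dist y z"
        using sep' by blast
    qed
    ultimately show ?thesis by simp
  qed simp
  interpret arc_distance D M "supported_below M"
  proof
    show "\<exists>u. (\<forall>i<M. u i \<in> supported_below M \<and> u i \<bullet> v = 0) \<and>
        (\<forall>i<M. \<forall>j<M. u i \<bullet> u j = (if i = j then 1 else 0))" for v :: "nat \<Rightarrow>\<^sub>0 complex"
      by (rule orthonormal_frame_supported_below[of M v]) blast
  qed (fact pos mono triangle D_cont packing subspace_supported_below complete_supported_below | simp add: D_def)+
  define F where "F x = real_coordinates M (curve (\<gamma>' x))" for x
  have F_dist: "eucl_dist (2 * M) (F (\<gamma> s)) (F (\<gamma> t)) = norm (curve t - curve s)"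
    if "0 \<le> s" "s \<le> 1" "0 \<le> t" "t \<le> 1" for s t
    using that homeomorphism_apply1[OF hom] curve(1)
    by (simp add: F_def eucl_dist_real_coordinates norm_minus_commute)
  \<comment> \<open>\<open>D\<close> lies between the distance and \<open>C\<close> times the
    distance; one constant covers both bounds because 512 is below 3840.\<close>
  have bilip: "inverse (3840 * C) * dist (\<gamma> s) (\<gamma> t) \<le> eucl_dist (2 * M) (F (\<gamma> s)) (F (\<gamma> t)) \<and>
      eucl_dist (2 * M) (F (\<gamma> s)) (F (\<gamma> t)) \<le> 3840 * C * dist (\<gamma> s) (\<gamma> t)"
    if st: "0 \<le> s" "s \<le> t" "t \<le> 1" for s t
  proof (cases "s = t")
    case True
    then show ?thesis using F_dist[of t t] st by simp
  next
    case False
    then have st': "s < t" using st by simp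
    have "dist (\<gamma> s) (\<gamma> t) / C \<le> dist (\<gamma> s) (\<gamma> t)"
      using C(1) by (simp add: divide_le_eq mult_right_mono[of 1 C, simplified] mult.commute)
    then have "inverse (3840 * C) * dist (\<gamma> s) (\<gamma> t) \<le> D s t / 3840"
      using dist_le[OF st] by (simp add: field_simps)
    moreover have "512 * D s t \<le> 3840 * C * dist (\<gamma> s) (\<gamma> t)"
      using turning[OF st] pos[OF st(1) st' st(3)] by simp
    ultimately show ?thesis
      using curve_bilipschitz[OF st(1) st' st(3)] F_dist[of s t] st by simp
  qed
  have sym: "eucl_dist n v w = eucl_dist n w v" for n v w
    by (simp add: eucl_dist_def L2_set_def power2_commute)
  have "bilipschitz_embedding X (2 * M) F"
    unfolding bilipschitz_embedding_def
  proof (intro conjI exI[of _ "3840 * C"] ballI)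
    show "F ` X \<subseteq> topspace (Euclidean_space (2 * M))"
      by (auto simp: topspace_Euclidean_space F_def real_coordinates_def)
    show "1 \<le> 3840 * C"
      using C(1) by simp
  next
    fix x y assume "x \<in> X" "y \<in> X"
    then obtain s t where st: "x = \<gamma> s" "y = \<gamma> t" "0 \<le> s" "s \<le> 1" "0 \<le> t" "t \<le> 1"
      using homeomorphism_image1[OF hom] by auto
    then have "inverse (3840 * C) * dist x y \<le> eucl_dist (2 * M) (F x) (F y) \<and>
        eucl_dist (2 * M) (F x) (F y) \<le> 3840 * C * dist x y"
      using bilip[of s t] bilip[of t s] by (cases "s \<le> t") (simp_all add: dist_commute sym[of _ "F (\<gamma> t)" "F (\<gamma> s)"])
    then show "inverse (3840 * C) * dist x y \<le> eucl_dist (2 * M) (F x) (F y)"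
      "eucl_dist (2 * M) (F x) (F y) \<le> 3840 * C * dist x y"
      by auto
  qed
  then show ?thesis by blast
qed

end
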